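(* Let $(W,T)$ be a (finite real) abstract reflection group and $c$ a Coxeter element of $(W,T)$. The group $W$ has the following presentation: $$W\;\simeq\;\langle\, T\mid \text{dual braid relations relative to } c,\ \text{ and } t^2=1 \text{ for all } t\in T\,\rangle_{\text{group}}.$$
   Context: An abstract (finite real) reflection group is a pair $(W,T)$ where $W$ is a finite group, $T\subset W$ generates $W$, and there is a faithful representation $\rho:W\hookrightarrow \mathrm{GL}(V_{\mathbb R})$, $V_{\mathbb R}$ a finite-dimensional real vector space, such that for all $w\in W$: $\operatorname{codim}\ker(\rho(w)-\mathrm{Id})=1 \Leftrightarrow w\in T$. For $w\in W$, $l_T(w)$ is the minimal length of an expression of $w$ as a product of elements of $T$. Write $w\prec_T w'$ if $l_T(w)+l_T(w^{-1}w')=l_T(w')$. A chromatic pair is an ordered pair $(L,R)$ of disjoint subsets of $T$ such that $\langle L\rangle$ and $\langle R\rangle$ are abelian and $(W,L\cup R)$ is a Coxeter system. The Coxeter elements of $(W,T)$ are the elements $\prod_{s\in L}s\prod_{s\in R}s$, $(L,R)$ a chromatic pair. The dual braid relations relative to $c$ are the relations $s\,t=(sts^{-1})\,s$ between words of length 2 on the alphabet $T$, where $s,t\in T$ are such that $st\prec_T c$. *)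

theory Defs
  imports "HOL-Analysis.Analysis" "HOL-Algebra.Algebra"
begin

definition general_linear_group :: "('v::real_vector \<Rightarrow> 'v) monoid" where
  "general_linear_group = \<lparr>carrier = {f. linear f \<and> bij f}, monoid.mult = (\<lambda>f g. f \<circ> g), one = id\<rparr>"

definition faithful_representation ::
    "('a, 'b) monoid_scheme \<Rightarrow> ('a \<Rightarrow> 'v::real_vector \<Rightarrow> 'v) \<Rightarrow> bool" where
  "faithful_representation W \<rho> \<longleftrightarrow>
     \<rho> \<in> hom W general_linear_group \<and> inj_on \<rho> (carrier W)"

text \<open>
  HOL cannot quantify existentially over the type \<open>'v\<close> underlying the representation space, so it
  is a parameter. A theorem that assumes \<open>abstract_reflection_group TYPE('v) W T\<close> with
  \<open>'v\<close> a type variable thus holds whenever such a space exists. Taking \<open>dim\<close> as the dimension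
  is meaningful because the whole space is required to have a finite spanning set.
\<close>

definition abstract_reflection_group ::
    "'v::real_vector itself \<Rightarrow> ('a, 'b) monoid_scheme \<Rightarrow> 'a set \<Rightarrow> bool" where
  "abstract_reflection_group V W T \<longleftrightarrow>
     group W \<and> finite (carrier W) \<and> T \<subseteq> carrier W \<and> generate W T = carrier W \<and>
     (\<exists>B :: 'v set. finite B \<and> span B = UNIV) \<and>
     (\<exists>\<rho> :: 'a \<Rightarrow> 'v \<Rightarrow> 'v. faithful_representation W \<rho> \<and>
        (\<forall>w \<in> carrier W. dim (UNIV :: 'v set) - dim {v. \<rho> w v - v = 0} = 1 \<longleftrightarrow> w \<in> T))"

text \<open>
  A letter \<open>(s, True)\<close> stands for the generator \<open>s\<close> and \<open>(s, False)\<close>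
  for its formal inverse; a relation is a pair of words to be identified.
\<close>

type_synonym 'g signed_word = "('g \<times> bool) list"

definition positive :: "'g list \<Rightarrow> 'g signed_word" where
  "positive xs = map (\<lambda>s. (s, True)) xs"

inductive pres_equiv ::
    "'g set \<Rightarrow> ('g signed_word \<times> 'g signed_word) set \<Rightarrow> 'g signed_word \<Rightarrow> 'g signed_word \<Rightarrow> bool"
  for S Rel where
  refl: "u \<in> lists (S \<times> UNIV) \<Longrightarrow> pres_equiv S Rel u u"
| sym: "pres_equiv S Rel u v \<Longrightarrow> pres_equiv S Rel v u"
| trans: "pres_equiv S Rel u v \<Longrightarrow> pres_equiv S Rel v w \<Longrightarrow> pres_equiv S Rel u w"
| cong: "pres_equiv S Rel u v \<Longrightarrow> x \<in> lists (S \<times> UNIV) \<Longrightarrow> y \<in> lists (S \<times> UNIV)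
           \<Longrightarrow> pres_equiv S Rel (x @ u @ y) (x @ v @ y)"
| cancel: "s \<in> S \<Longrightarrow> pres_equiv S Rel [(s, b), (s, \<not> b)] []"
| relation: "(u, v) \<in> Rel \<Longrightarrow> u \<in> lists (S \<times> UNIV) \<Longrightarrow> v \<in> lists (S \<times> UNIV)
           \<Longrightarrow> pres_equiv S Rel u v"

definition pres_class ::
    "'g set \<Rightarrow> ('g signed_word \<times> 'g signed_word) set \<Rightarrow> 'g signed_word \<Rightarrow> 'g signed_word set" where
  "pres_class S Rel u = {v. pres_equiv S Rel u v}"

definition presented_group ::
    "'g set \<Rightarrow> ('g signed_word \<times> 'g signed_word) set \<Rightarrow> 'g signed_word set monoid" where
  "presented_group S Rel =
     \<lparr>carrier = pres_class S Rel ` lists (S \<times> UNIV),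
      monoid.mult = (\<lambda>A B. \<Union>u\<in>A. \<Union>v\<in>B. pres_class S Rel (u @ v)),
      one = pres_class S Rel []\<rparr>"

definition has_presentation ::
    "('g, 'b) monoid_scheme \<Rightarrow> 'g set \<Rightarrow> ('g signed_word \<times> 'g signed_word) set \<Rightarrow> bool" where
  "has_presentation W S Rel \<longleftrightarrow> S \<subseteq> carrier W \<and>
     (\<exists>\<phi> \<in> iso (presented_group S Rel) W. \<forall>s\<in>S. \<phi> (pres_class S Rel [(s, True)]) = s)"

text \<open>
  \<open>group.ord W x = 0\<close> if \<open>x\<close> has infinite order, in which case the
  corresponding relation below is trivial, as it should be. The pairs with \<open>s = t\<close> contribute
  the relations \<open>s\<^sup>2 = 1\<close>.
\<close>

definition coxeter_relations ::
    "('g, 'b) monoid_scheme \<Rightarrow> 'g set \<Rightarrow> ('g signed_word \<times> 'g signed_word) set" where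
  "coxeter_relations W S =
     {(positive (concat (replicate (group.ord W (s \<otimes>\<^bsub>W\<^esub> t)) [s, t])), []) | s t. s \<in> S \<and> t \<in> S}"

definition coxeter_system :: "('g, 'b) monoid_scheme \<Rightarrow> 'g set \<Rightarrow> bool" where
  "coxeter_system W S \<longleftrightarrow> group W \<and> S \<subseteq> carrier W \<and> (\<forall>s\<in>S. group.ord W s = 2) \<and>
     has_presentation W S (coxeter_relations W S)"

definition list_product :: "('a, 'b) monoid_scheme \<Rightarrow> 'a list \<Rightarrow> 'a" where
  "list_product W xs = foldr (\<otimes>\<^bsub>W\<^esub>) xs \<one>\<^bsub>W\<^esub>"

definition refl_length :: "('a, 'b) monoid_scheme \<Rightarrow> 'a set \<Rightarrow> 'a \<Rightarrow> nat" where
  "refl_length W T w = (LEAST n. \<exists>xs \<in> lists T. length xs = n \<and> list_product W xs = w)"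

definition refl_prec :: "('a, 'b) monoid_scheme \<Rightarrow> 'a set \<Rightarrow> 'a \<Rightarrow> 'a \<Rightarrow> bool" where
  "refl_prec W T w w' \<longleftrightarrow>
     refl_length W T w + refl_length W T (inv\<^bsub>W\<^esub> w \<otimes>\<^bsub>W\<^esub> w') = refl_length W T w'"

definition chromatic_pair :: "('a, 'b) monoid_scheme \<Rightarrow> 'a set \<Rightarrow> 'a set \<Rightarrow> 'a set \<Rightarrow> bool" where
  "chromatic_pair W T L R \<longleftrightarrow> L \<subseteq> T \<and> R \<subseteq> T \<and> L \<inter> R = {} \<and>
     comm_group (subgroup_generated W L) \<and> comm_group (subgroup_generated W R) \<and>
     coxeter_system W (L \<union> R)"

text \<open>
  The products over \<open>L\<close> and \<open>R\<close> are taken in the abelian subgroups they generate, since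
  \<open>finprod\<close> is only meaningful in a commutative monoid.
\<close>

definition coxeter_element :: "('a, 'b) monoid_scheme \<Rightarrow> 'a set \<Rightarrow> 'a \<Rightarrow> bool" where
  "coxeter_element W T c \<longleftrightarrow> (\<exists>L R. chromatic_pair W T L R \<and>
     c = finprod (subgroup_generated W L) (\<lambda>s. s) L \<otimes>\<^bsub>W\<^esub> finprod (subgroup_generated W R) (\<lambda>s. s) R)"

definition dual_braid_relations ::
    "('a, 'b) monoid_scheme \<Rightarrow> 'a set \<Rightarrow> 'a \<Rightarrow> ('a signed_word \<times> 'a signed_word) set" where
  "dual_braid_relations W T c =
     {(positive [s, t], positive [s \<otimes>\<^bsub>W\<^esub> t \<otimes>\<^bsub>W\<^esub> inv\<^bsub>W\<^esub> s, s]) | s t.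
        s \<in> T \<and> t \<in> T \<and> refl_prec W T (s \<otimes>\<^bsub>W\<^esub> t) c}"

definition square_relations :: "'a set \<Rightarrow> ('a signed_word \<times> 'a signed_word) set" where
  "square_relations T = {(positive [t, t], []) | t. t \<in> T}"

end

theory Submission
  imports Defs "HOL-Library.Function_Algebras"
begin

text \<open>
  Let \<open>S = L \<union> R\<close>, let \<open>c = s\<^sub>1 \<cdots> s\<^sub>n\<close> be the Coxeter element and let \<open>G\<close> be the presented group. In the
  dihedral group generated by two simple reflections the dual braid relations and \<open>t\<^sup>2 = 1\<close> imply the
  Coxeter relation, so the Coxeter presentation of \<open>W\<close> gives a homomorphism \<open>W \<rightarrow> G\<close>, a section of the
  canonical map \<open>G \<rightarrow> W\<close>. It remains to see that it is onto, that is, that the generator of \<open>G\<close>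
  belonging to any \<open>t \<in> T\<close> is a product of generators belonging to \<open>S\<close>.

  In the geometric representation attached to \<open>(W, S)\<close>, the Coxeter element has no nonzero fixed vector.
  Hence \<open>c\<close> has reflection length \<open>n\<close>, and Hurwitz moves on its reduced expressions are instances of the
  dual braid relations; and no orbit of positive roots under \<open>c\<close> stays positive, so each \<open>t\<close> is conjugate by
  a power of \<open>c\<close> to some \<open>(s\<^sub>i\<^sub>+\<^sub>1 \<cdots> s\<^sub>n)\<^sup>-\<^sup>1 s\<^sub>i (s\<^sub>i\<^sub>+\<^sub>1 \<cdots> s\<^sub>n)\<close>. Starting from \<open>s\<^sub>1 \<cdots> s\<^sub>n\<close>, Hurwitz moves
  therefore lead to \<open>t\<close>.

  The given faithful representation is only used to show that every \<open>t \<in> T\<close> is conjugate to an element of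
  \<open>S\<close>: it need not be the geometric one, since \<open>S\<close> need not be the set of walls of a chamber there.
\<close>

section \<open>Presented groups\<close>

definition word_eval :: "('h, 'b) monoid_scheme \<Rightarrow> ('g \<Rightarrow> 'h) \<Rightarrow> 'g signed_word \<Rightarrow> 'h" where
  "word_eval H f u =
     foldr (\<lambda>(s, b) x. (if b then f s else inv\<^bsub>H\<^esub> (f s)) \<otimes>\<^bsub>H\<^esub> x) u \<one>\<^bsub>H\<^esub>"

lemma word_eval_Nil [simp]: "word_eval H f [] = \<one>\<^bsub>H\<^esub>"
  by (simp add: word_eval_def)

lemma word_eval_Cons [simp]:
  "word_eval H f ((s, b) # u) = (if b then f s else inv\<^bsub>H\<^esub> (f s)) \<otimes>\<^bsub>H\<^esub> word_eval H f u"
  by (simp add: word_eval_def)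

lemma word_eval_closed:
  assumes "group H" "f \<in> S \<rightarrow> carrier H" "u \<in> lists (S \<times> UNIV)"
  shows "word_eval H f u \<in> carrier H"
proof -
  interpret group H by fact
  show ?thesis using assms(3)
  proof (induction u)
    case (Cons a u)
    then show ?case using assms(2) by (cases a) (auto simp: Pi_iff)
  qed simp
qed

lemma word_eval_append:
  assumes "group H" "f \<in> S \<rightarrow> carrier H" "u \<in> lists (S \<times> UNIV)" "v \<in> lists (S \<times> UNIV)"
  shows "word_eval H f (u @ v) = word_eval H f u \<otimes>\<^bsub>H\<^esub> word_eval H f v"
proof -
  interpret group H by fact
  note cl = word_eval_closed[OF assms(1,2)]
  show ?thesis using assms(3)
  proof (induction u)
    case Nil
    then show ?case using cl[OF assms(4)] by simp
  next
    case (Cons a u)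
    then show ?case
      using cl[of u] cl[OF assms(4)] assms(2) by (cases a) (auto simp: m_assoc Pi_iff)
  qed
qed

section \<open>Equivalence of words and the group of classes\<close>

lemma pres_equiv_in_lists:
  assumes "pres_equiv S R u v"
  shows "u \<in> lists (S \<times> UNIV) \<and> v \<in> lists (S \<times> UNIV)"
  using assms by induction auto

lemma pres_equiv_word_eval:
  assumes "group H" "f \<in> S \<rightarrow> carrier H"
    and rel: "\<And>u v. (u, v) \<in> R \<Longrightarrow> u \<in> lists (S \<times> UNIV) \<Longrightarrow> v \<in> lists (S \<times> UNIV)
      \<Longrightarrow> word_eval H f u = word_eval H f v"
    and "pres_equiv S R u v"
  shows "word_eval H f u = word_eval H f v"
proof -
  interpret group H by fact
  note app = word_eval_append[OF assms(1,2)]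
  show ?thesis using assms(4)
  proof induction
    case (cong u v x y)
    then show ?case using pres_equiv_in_lists[OF cong.hyps(1)] by (simp add: app)
  next
    case (cancel s b)
    then have "f s \<in> carrier H" using assms(2) by auto
    then show ?case by (cases b) auto
  qed (auto simp: rel)
qed

lemma pres_class_eq_iff:
  assumes "u \<in> lists (S \<times> UNIV)"
  shows "pres_class S R u = pres_class S R v \<longleftrightarrow> pres_equiv S R u v"
proof
  assume "pres_class S R u = pres_class S R v"
  then have "u \<in> pres_class S R v"
    using pres_equiv.refl[OF assms] by (auto simp: pres_class_def)
  then show "pres_equiv S R u v" by (simp add: pres_class_def pres_equiv.sym)
next
  assume "pres_equiv S R u v"
  then show "pres_class S R u = pres_class S R v"
    unfolding pres_class_def by (blast intro: pres_equiv.sym pres_equiv.trans)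
qed

lemma pres_equiv_append:
  assumes "pres_equiv S R u u'" "pres_equiv S R v v'"
  shows "pres_equiv S R (u @ v) (u' @ v')"
proof -
  have "pres_equiv S R ([] @ u @ v) ([] @ u' @ v)"
    using pres_equiv.cong[OF assms(1), of "[]" v] pres_equiv_in_lists[OF assms(2)] by simp
  moreover have "pres_equiv S R (u' @ v @ []) (u' @ v' @ [])"
    using pres_equiv.cong[OF assms(2), of u' "[]"] pres_equiv_in_lists[OF assms(1)] by simp
  ultimately show ?thesis using pres_equiv.trans[of S R "u @ v" "u' @ v" "u' @ v'"] by simp
qed

lemma presented_group_mult:
  assumes "u \<in> lists (S \<times> UNIV)" "v \<in> lists (S \<times> UNIV)"
  shows "pres_class S R u \<otimes>\<^bsub>presented_group S R\<^esub> pres_class S R v = pres_class S R (u @ v)"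
proof -
  have "pres_class S R (u' @ v') = pres_class S R (u @ v)"
    if "u' \<in> pres_class S R u" "v' \<in> pres_class S R v" for u' v'
    using that pres_equiv_append[of S R u u' v v'] assms
    by (subst eq_commute, subst pres_class_eq_iff) (auto simp: pres_class_def)
  moreover have "u \<in> pres_class S R u" "v \<in> pres_class S R v"
    using assms by (auto simp: pres_class_def intro: pres_equiv.refl)
  ultimately have "(\<Union>u'\<in>pres_class S R u. \<Union>v'\<in>pres_class S R v. pres_class S R (u' @ v'))
      = pres_class S R (u @ v)"
    by blast
  then show ?thesis by (simp add: presented_group_def)
qed

lemma carrier_presented_group:
  "carrier (presented_group S R) = pres_class S R ` lists (S \<times> UNIV)"
  by (simp add: presented_group_def)

lemma one_presented_group: "\<one>\<^bsub>presented_group S R\<^esub> = pres_class S R []"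
  by (simp add: presented_group_def)

text \<open>The flipped first letter is appended to an inverse of the remaining word. A left inverse
  suffices for \<open>groupI\<close>.\<close>

lemma pres_equiv_left_inverse:
  "u \<in> lists (S \<times> UNIV) \<Longrightarrow> \<exists>v\<in>lists (S \<times> UNIV). pres_equiv S R (v @ u) []"
proof (induction u)
  case Nil
  show ?case by (rule bexI[of _ "[]"]) (auto intro: pres_equiv.refl)
next
  case (Cons a u)
  obtain s b where a: "a = (s, b)" by (cases a)
  obtain v where v: "v \<in> lists (S \<times> UNIV)" "pres_equiv S R (v @ u) []"
    using Cons by auto
  have s: "s \<in> S" using Cons.prems a by auto
  have "pres_equiv S R [(s, \<not> b), (s, b)] []"
    using pres_equiv.cancel[OF s, of R "\<not> b"] by simp
  from pres_equiv.cong[OF this, of v u] v Cons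
  have "pres_equiv S R (v @ [(s, \<not> b), (s, b)] @ u) (v @ u)" by auto
  then have "pres_equiv S R ((v @ [(s, \<not> b)]) @ a # u) []"
    using pres_equiv.trans[OF _ v(2)] a by simp
  then show ?case using v(1) s by (intro bexI[of _ "v @ [(s, \<not> b)]"]) auto
qed

lemma group_presented_group: "group (presented_group S R)"
proof (rule groupI)
  fix x assume "x \<in> carrier (presented_group S R)"
  then obtain u where u: "u \<in> lists (S \<times> UNIV)" "x = pres_class S R u"
    by (auto simp: carrier_presented_group)
  obtain v where "v \<in> lists (S \<times> UNIV)" "pres_equiv S R (v @ u) []"
    using pres_equiv_left_inverse[OF u(1)] by auto
  then show "\<exists>y\<in>carrier (presented_group S R).
      y \<otimes>\<^bsub>presented_group S R\<^esub> x = \<one>\<^bsub>presented_group S R\<^esub>"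
    using u by (intro bexI[of _ "pres_class S R v"])
      (auto simp: carrier_presented_group presented_group_mult one_presented_group pres_class_eq_iff)
qed (auto simp: carrier_presented_group presented_group_mult one_presented_group
  del: in_listsD in_listsI)

text \<open>A class is evaluated at a representative picked by \<open>SOME\<close>; the choice is
  harmless once the relations hold in \<open>H\<close>, by \<open>pres_lift_class\<close>.\<close>

definition pres_lift ::
    "('h, 'b) monoid_scheme \<Rightarrow> ('g \<Rightarrow> 'h) \<Rightarrow> 'g signed_word set \<Rightarrow> 'h" where
  "pres_lift H f A = word_eval H f (SOME u. u \<in> A)"

text \<open>Von Dyck's theorem: equivalent words have equal values in \<open>H\<close> by
  \<open>pres_equiv_word_eval\<close>, so evaluation descends to classes.\<close>

lemma pres_lift:
  assumes "group H" "f \<in> S \<rightarrow> carrier H"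
    and rel: "\<And>u v. (u, v) \<in> R \<Longrightarrow> u \<in> lists (S \<times> UNIV) \<Longrightarrow> v \<in> lists (S \<times> UNIV)
      \<Longrightarrow> word_eval H f u = word_eval H f v"
  shows pres_lift_class: "\<And>u. u \<in> lists (S \<times> UNIV) \<Longrightarrow> pres_lift H f (pres_class S R u) = word_eval H f u"
    and pres_lift_hom: "pres_lift H f \<in> hom (presented_group S R) H"
    and pres_lift_generator: "\<And>s. s \<in> S \<Longrightarrow> pres_lift H f (pres_class S R [(s, True)]) = f s"
proof -
  interpret group H by fact
  show cls: "pres_lift H f (pres_class S R u) = word_eval H f u" if u: "u \<in> lists (S \<times> UNIV)" for u
  proof -
    have "u \<in> pres_class S R u" using u by (simp add: pres_class_def pres_equiv.refl)
    then have "(SOME v. v \<in> pres_class S R u) \<in> pres_class S R u" by (rule someI)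
    then have "pres_equiv S R u (SOME v. v \<in> pres_class S R u)" by (simp add: pres_class_def)
    from pres_equiv_word_eval[OF assms(1,2) rel this] show ?thesis by (simp add: pres_lift_def)
  qed
  show "pres_lift H f \<in> hom (presented_group S R) H"
    using word_eval_closed[OF assms(1,2)] word_eval_append[OF assms(1,2)]
    by (auto simp: hom_def carrier_presented_group presented_group_mult cls
      del: in_listsD in_listsI)
  show "pres_lift H f (pres_class S R [(s, True)]) = f s" if "s \<in> S" for s
  proof -
    have "f s \<in> carrier H" using that assms(2) by auto
    then show ?thesis using that by (simp add: cls)
  qed
qed

lemma hom_eq_on_words:
  assumes "group P" "group H" "\<phi> \<in> hom P H" "f \<in> S \<rightarrow> carrier P" "u \<in> lists (S \<times> UNIV)"
  shows "\<phi> (word_eval P f u) = word_eval H (\<phi> \<circ> f) u"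
proof -
  interpret group_hom P H \<phi> using assms by (simp add: group_hom_def group_hom_axioms_def)
  show ?thesis using assms(5)
  proof (induction u)
    case (Cons a u)
    then show ?case using word_eval_closed[OF assms(1,4), of u] assms(4)
      by (cases a) (auto simp: Pi_iff)
  qed simp
qed

text \<open>The class of \<open>(s, False)\<close> is the inverse of that of
  \<open>(s, True)\<close>. Homomorphisms out of the presented group can then be computed letter by
  letter.\<close>

lemma pres_class_word_eval:
  assumes "u \<in> lists (S \<times> UNIV)"
  shows "pres_class S R u = word_eval (presented_group S R) (\<lambda>s. pres_class S R [(s, True)]) u"
  using assms
proof (induction u)
  case Nil
  show ?case by (simp add: one_presented_group)
next
  case (Cons a u)
  interpret group "presented_group S R" by (rule group_presented_group)
  obtain s b where a: "a = (s, b)" by (cases a)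
  have s: "s \<in> S" using Cons a by auto
  have "inv\<^bsub>presented_group S R\<^esub> pres_class S R [(s, True)] = pres_class S R [(s, False)]"
    using s pres_equiv.cancel[OF s, of R False]
    by (intro inv_equality)
      (auto simp: presented_group_mult carrier_presented_group one_presented_group pres_class_eq_iff)
  moreover have "pres_class S R (a # u)
      = pres_class S R [(s, b)] \<otimes>\<^bsub>presented_group S R\<^esub> pres_class S R u"
    using Cons s a by (subst presented_group_mult) auto
  ultimately show ?case using Cons a by auto
qed

lemma has_presentation_words:
  assumes "group W" "has_presentation W S R" "w \<in> carrier W"
  shows "\<exists>u\<in>lists (S \<times> UNIV). w = word_eval W (\<lambda>s. s) u"
proof -
  let ?P = "presented_group S R" and ?f = "\<lambda>s. pres_class S R [(s, True)]"
  obtain \<phi> where \<phi>: "\<phi> \<in> iso ?P W" "\<And>s. s \<in> S \<Longrightarrow> \<phi> (?f s) = s" and S: "S \<subseteq> carrier W"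
    using assms(2) by (auto simp: has_presentation_def)
  obtain u where u: "u \<in> lists (S \<times> UNIV)" "w = \<phi> (pres_class S R u)"
    using \<phi>(1) assms(3) by (auto simp: iso_def bij_betw_def carrier_presented_group)
  have "\<phi> (pres_class S R u) = word_eval W (\<phi> \<circ> ?f) u"
    using u(1) \<phi>(1) hom_eq_on_words[OF group_presented_group assms(1), of \<phi> S R ?f S u]
    by (auto simp: pres_class_word_eval[OF u(1)] iso_def carrier_presented_group)
  also have "\<dots> = word_eval W (\<lambda>s. s) u"
    using u(1) by (induction u) (auto simp: \<phi>(2))
  finally show ?thesis using u by auto
qed

text \<open>Inverting the isomorphism with the presented group and following it by
  \<open>pres_lift\<close> makes von Dyck's theorem apply to \<open>W\<close> itself.\<close>

lemma has_presentation_extend: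
  assumes "group W" "has_presentation W S R" "group H" "f \<in> S \<rightarrow> carrier H"
    and "\<And>u v. (u, v) \<in> R \<Longrightarrow> u \<in> lists (S \<times> UNIV) \<Longrightarrow> v \<in> lists (S \<times> UNIV)
      \<Longrightarrow> word_eval H f u = word_eval H f v"
  shows "\<exists>h\<in>hom W H. \<forall>s\<in>S. h s = f s"
proof -
  let ?P = "presented_group S R"
  obtain \<phi> where \<phi>: "\<phi> \<in> iso ?P W" "\<And>s. s \<in> S \<Longrightarrow> \<phi> (pres_class S R [(s, True)]) = s"
    using assms(2) by (auto simp: has_presentation_def)
  define \<psi> where "\<psi> = inv_into (carrier ?P) \<phi>"
  have \<psi>: "\<psi> \<in> iso W ?P"
    unfolding \<psi>_def by (rule group.iso_set_sym[OF group_presented_group \<phi>(1)])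
  have "\<psi> s = pres_class S R [(s, True)]" if "s \<in> S" for s
    using that \<phi> unfolding \<psi>_def
    by (intro inv_into_f_eq) (auto simp: iso_def bij_betw_def carrier_presented_group)
  moreover have "pres_lift H f \<circ> \<psi> \<in> hom W H"
    using pres_lift_hom[OF assms(3,4,5)] \<psi> by (intro hom_compose[of _ _ ?P]) (auto simp: iso_def)
  ultimately show ?thesis
    using pres_lift_generator[OF assms(3,4,5)] by (intro bexI[of _ "pres_lift H f \<circ> \<psi>"]) auto
qed

section \<open>Products of lists in a group\<close>

lemma list_product_Nil [simp]: "list_product W [] = \<one>\<^bsub>W\<^esub>"
  by (simp add: list_product_def)

lemma list_product_Cons [simp]: "list_product W (x # xs) = x \<otimes>\<^bsub>W\<^esub> list_product W xs"
  by (simp add: list_product_def)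

lemma word_eval_positive: "word_eval H f (positive xs) = list_product H (map f xs)"
  by (induction xs) (auto simp: positive_def)

context group
begin

lemma list_product_closed [simp]: "set xs \<subseteq> carrier G \<Longrightarrow> list_product G xs \<in> carrier G"
  by (induction xs) auto

lemma list_product_append [simp]:
  "set xs \<subseteq> carrier G \<Longrightarrow> set ys \<subseteq> carrier G
    \<Longrightarrow> list_product G (xs @ ys) = list_product G xs \<otimes> list_product G ys"
  by (induction xs) (auto simp: m_assoc)

lemma list_product_concat_replicate:
  "set xs \<subseteq> carrier G \<Longrightarrow> list_product G (concat (replicate n xs)) = list_product G xs [^] n"
proof (induction n)
  case (Suc n)
  have "set (concat (replicate n xs)) \<subseteq> carrier G" using Suc.prems by auto
  then show ?case
    using Suc nat_pow_Suc2[OF list_product_closed[OF Suc.prems], of n] by simp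
qed simp

lemma list_product_conjugate:
  assumes "g \<in> carrier G" "set xs \<subseteq> carrier G"
  shows "list_product G (map (\<lambda>x. inv g \<otimes> x \<otimes> g) xs) = inv g \<otimes> list_product G xs \<otimes> g"
  using assms(2)
proof (induction xs)
  case Nil
  then show ?case using assms(1) by simp
next
  case (Cons x xs)
  then have cl: "x \<in> carrier G" "list_product G xs \<in> carrier G" by auto
  have "inv g \<otimes> x \<otimes> g \<otimes> (inv g \<otimes> list_product G xs \<otimes> g)
      = inv g \<otimes> x \<otimes> (g \<otimes> inv g) \<otimes> list_product G xs \<otimes> g"
    using cl assms(1) by (simp only: m_assoc m_closed inv_closed)
  then show ?case using Cons cl assms(1) by (simp add: m_assoc)
qed

end

section \<open>The geometric representation of a finite Coxeter group\<close>

text \<open>The geometric representation acts on functions \<open>'a \<Rightarrow> real\<close>: the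
  simple roots are indexed by the set \<open>S\<close>, which is not a type, so coordinates are
  indexed by the whole type \<open>'a\<close>.\<close>

instantiation "fun" :: (type, real_vector) real_vector
begin

definition "r *\<^sub>R f = (\<lambda>x. r *\<^sub>R f x)"

instance
  by standard (simp_all add: scaleR_fun_def fun_eq_iff scaleR_add_right scaleR_add_left)

end

lemma scaleR_fun_apply [simp]: "(r *\<^sub>R f) x = r *\<^sub>R f x"
  by (simp add: scaleR_fun_def)

lemma sum_fun_apply [simp]: "(\<Sum>i\<in>I. f i) x = (\<Sum>i\<in>I. f i x)"
  for f :: "'i \<Rightarrow> 'a \<Rightarrow> 'b::comm_monoid_add"
  by (induction I rule: infinite_finite_induct) auto

lemma group_general_linear_group: "group (general_linear_group :: ('v::real_vector \<Rightarrow> 'v) monoid)"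
proof (rule groupI)
  fix f :: "'v \<Rightarrow> 'v" assume "f \<in> carrier general_linear_group"
  then have f: "linear f" "bij f" by (auto simp: general_linear_group_def)
  have [simp]: "f (inv_into UNIV f x) = x" for x using f(2) by (simp add: bij_is_surj surj_f_inv_f)
  have inv_eq: "inv_into UNIV f y = x" if "f x = y" for x y using f(2) that by (metis bij_inv_eq_iff)
  have "linear (inv_into UNIV f)"
  proof (rule linearI)
    show "inv_into UNIV f (x + y) = inv_into UNIV f x + inv_into UNIV f y" for x y
      by (rule inv_eq) (simp add: linear_add[OF f(1)])
    show "inv_into UNIV f (r *\<^sub>R x) = r *\<^sub>R inv_into UNIV f x" for r x
      by (rule inv_eq) (simp add: linear_scale[OF f(1)])
  qed
  then show "\<exists>g\<in>carrier general_linear_group.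
      g \<otimes>\<^bsub>general_linear_group\<^esub> f = \<one>\<^bsub>general_linear_group\<^esub>"
    using f(2) by (intro bexI[of _ "inv_into UNIV f"])
      (auto simp: general_linear_group_def bij_imp_bij_inv bij_is_inj)
qed (auto simp: general_linear_group_def linear_compose bij_comp comp_assoc linear_id[unfolded id_def] bij_id[unfolded id_def] id_def)

lemma general_linear_group_pow: "f [^]\<^bsub>general_linear_group\<^esub> (n::nat) = f ^^ n"
  by (induction n) (simp_all add: nat_pow_def general_linear_group_def funpow_swap1 fun_eq_iff)

locale finite_coxeter_group = group W for W (structure) +
  fixes S
  assumes finite_carrier: "finite (carrier W)" and coxeter: "coxeter_system W S"
begin

lemma S_carrier: "S \<subseteq> carrier W"
  using coxeter by (simp add: coxeter_system_def)

lemma S_closed [simp, intro]: "s \<in> S \<Longrightarrow> s \<in> carrier W"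
  using S_carrier by auto

lemma finite_S: "finite S"
  using S_carrier finite_carrier finite_subset by auto

lemma S_square: "s \<in> S \<Longrightarrow> s \<otimes> s = \<one>"
  using coxeter pow_ord_eq_1[of s] by (auto simp: coxeter_system_def numeral_2_eq_2)

lemma S_inv: "s \<in> S \<Longrightarrow> inv s = s"
  using S_square by (intro inv_equality) auto

lemma S_cancel [simp]: "s \<in> S \<Longrightarrow> x \<in> carrier W \<Longrightarrow> s \<otimes> (s \<otimes> x) = x"
  by (simp add: m_assoc[symmetric] S_square)

lemma S_cancel_right [simp]: "s \<in> S \<Longrightarrow> x \<in> carrier W \<Longrightarrow> x \<otimes> s \<otimes> s = x"
  by (simp add: m_assoc S_square)

section \<open>The Tits form and its reflections\<close>

definition coxeter_order where "coxeter_order s t = ord (s \<otimes> t)"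

lemma coxeter_order_commute: "s \<in> S \<Longrightarrow> t \<in> S \<Longrightarrow> coxeter_order s t = coxeter_order t s"
proof -
  assume st: "s \<in> S" "t \<in> S"
  then have "t \<otimes> s = inv (s \<otimes> t)" by (simp add: inv_mult_group S_inv)
  then show ?thesis using st by (simp add: coxeter_order_def ord_inv)
qed

lemma coxeter_order_self: "s \<in> S \<Longrightarrow> coxeter_order s s = 1"
  by (simp add: coxeter_order_def S_square)

lemma coxeter_order_ge_2:
  assumes "s \<in> S" "t \<in> S" "s \<noteq> t"
  shows "coxeter_order s t \<ge> 2"
proof -
  have "s \<otimes> t \<noteq> \<one>"
  proof
    assume "s \<otimes> t = \<one>"
    then have "s = inv t" using assms by (simp add: inv_equality)
    then show False using assms S_inv by auto
  qed
  then have "coxeter_order s t \<noteq> 1"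
    using assms ord_eq_1[of "s \<otimes> t"] by (auto simp: coxeter_order_def)
  moreover have "coxeter_order s t \<ge> 1"
    using assms finite_carrier ord_ge_1[of "s \<otimes> t"] by (auto simp: coxeter_order_def)
  ultimately show ?thesis by simp
qed

text \<open>The matrix of the Tits form: the simple roots of \<open>s\<close> and \<open>t\<close>
  enclose the angle \<pi> - \<pi>/m with m the order of \<open>s \<otimes> t\<close>. On the
  diagonal that order is 1 and the entry is 1.\<close>

definition gram where "gram s t = - cos (pi / real (coxeter_order s t))"

text \<open>Coordinates outside \<open>S\<close> do not enter, so the form vanishes on functions
  supported there; \<open>act_support\<close> and \<open>root_support\<close> control these
  coordinates.\<close>

definition bil :: "('a \<Rightarrow> real) \<Rightarrow> ('a \<Rightarrow> real) \<Rightarrow> real" where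
  "bil x y = (\<Sum>r\<in>S. \<Sum>t\<in>S. gram r t * x r * y t)"

definition reflect :: "('a \<Rightarrow> real) \<Rightarrow> ('a \<Rightarrow> real) \<Rightarrow> ('a \<Rightarrow> real)" where
  "reflect b x = x - (2 * bil b x) *\<^sub>R b"

definition simple :: "'a \<Rightarrow> 'a \<Rightarrow> real" where
  "simple s = (\<lambda>r. if r = s then 1 else 0)"

lemma simple_apply: "simple s r = (if r = s then 1 else 0)"
  by (simp add: simple_def)

lemma bil_commute: "bil x y = bil y x"
proof -
  have "bil x y = (\<Sum>t\<in>S. \<Sum>r\<in>S. gram r t * x r * y t)"
    unfolding bil_def by (rule sum.swap)
  also have "\<dots> = bil y x"
    unfolding bil_def
    by (intro sum.cong) (auto simp: gram_def coxeter_order_commute)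
  finally show ?thesis .
qed

lemma bil_add_right: "bil x (y + z) = bil x y + bil x z"
  by (simp add: bil_def distrib_left sum.distrib)

lemma bil_scale_right: "bil x (a *\<^sub>R y) = a * bil x y"
  by (simp add: bil_def sum_distrib_left mult_ac)

lemma bil_diff_right: "bil x (y - z) = bil x y - bil x z"
  by (simp add: bil_def right_diff_distrib sum_subtractf)

lemma bil_add_left: "bil (x + y) z = bil x z + bil y z"
  by (simp add: bil_commute[of _ z] bil_add_right)

lemma bil_scale_left: "bil (a *\<^sub>R x) z = a * bil x z"
  by (simp add: bil_commute[of _ z] bil_scale_right)

lemma bil_diff_left: "bil (x - y) z = bil x z - bil y z"
  by (simp add: bil_commute[of _ z] bil_diff_right)

lemmas bil_simps = bil_add_right bil_scale_right bil_diff_right bil_add_left bil_scale_left bil_diff_left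

lemma bil_simple: "s \<in> S \<Longrightarrow> t \<in> S \<Longrightarrow> bil (simple s) (simple t) = gram s t"
proof -
  assume st: "s \<in> S" "t \<in> S"
  have "gram r u * simple s r * simple t u = (if u = t then if r = s then gram s t else 0 else 0)"
    for r u by (simp add: simple_apply)
  then show ?thesis using st by (simp add: bil_def finite_S)
qed

lemma bil_simple_self: "s \<in> S \<Longrightarrow> bil (simple s) (simple s) = 1"
  by (simp add: bil_simple gram_def coxeter_order_self)

lemma linear_reflect: "linear (reflect b)"
  by (rule linearI) (auto simp: reflect_def bil_simps algebra_simps)

lemma reflect_reflect: "bil b b = 1 \<Longrightarrow> reflect b (reflect b x) = x"
  by (simp add: reflect_def bil_simps algebra_simps)

lemma reflect_self: "bil b b = 1 \<Longrightarrow> reflect b b = - b"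
  by (simp add: reflect_def scaleR_2)

lemma bil_reflect: "bil b b = 1 \<Longrightarrow> bil (reflect b x) (reflect b y) = bil x y"
  by (simp add: reflect_def bil_simps bil_commute[of x b] algebra_simps)

lemma reflect_in_general_linear_group:
  assumes "bil b b = 1"
  shows "reflect b \<in> carrier general_linear_group"
proof -
  have "bij (reflect b)" by (rule o_bij[of "reflect b"]) (auto simp: reflect_reflect[OF assms])
  then show ?thesis by (simp add: general_linear_group_def linear_reflect)
qed

lemma reflect_simple_other: "r \<noteq> s \<Longrightarrow> reflect (simple s) x r = x r"
  by (simp add: reflect_def simple_apply)

section \<open>The plane spanned by two simple roots\<close>

context
  fixes s t \<theta>
  assumes s: "s \<in> S" and t: "t \<in> S" and st: "s \<noteq> t"
    and \<theta>: "\<theta> = pi / real (coxeter_order s t)"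
begin

text \<open>This is sin \<theta> times the unit vector at angle \<open>\<phi>\<close> from
  \<open>simple s\<close> towards \<open>simple t\<close>, the two enclosing the angle \<pi> -
  \<theta>. In \<open>plane_vec'\<close> the angle is measured from \<open>simple t\<close> instead.
  With both, each reflection becomes a shift of the angle by \<theta>.\<close>

definition plane_vec :: "real \<Rightarrow> 'a \<Rightarrow> real" where
  "plane_vec \<phi> = sin (\<phi> + \<theta>) *\<^sub>R simple s + sin \<phi> *\<^sub>R simple t"

definition plane_vec' :: "real \<Rightarrow> 'a \<Rightarrow> real" where
  "plane_vec' \<phi> = sin \<phi> *\<^sub>R simple s + sin (\<phi> + \<theta>) *\<^sub>R simple t"

lemma sin_theta_pos: "sin \<theta> > 0"
proof -
  have "coxeter_order s t \<ge> 2" using s t st by (rule coxeter_order_ge_2)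
  then have "\<theta> > 0" "\<theta> < pi" by (auto simp: \<theta> field_simps)
  then show ?thesis by (rule sin_gt_zero)
qed

lemma bil_st: "bil (simple s) (simple t) = - cos \<theta>" "bil (simple t) (simple s) = - cos \<theta>"
  using s t by (auto simp: bil_simple gram_def \<theta> coxeter_order_commute)

lemma sin_recursion: "2 * cos \<theta> * sin (\<phi> + \<theta>) = sin \<phi> + sin (\<phi> + 2 * \<theta>)"
proof -
  have "sin \<phi> + sin (\<phi> + 2 * \<theta>) = sin ((\<phi> + \<theta>) - \<theta>) + sin ((\<phi> + \<theta>) + \<theta>)"
    by (simp add: algebra_simps)
  also have "\<dots> = 2 * cos \<theta> * sin (\<phi> + \<theta>)"
    unfolding sin_add[of "\<phi> + \<theta>" \<theta>] sin_diff[of "\<phi> + \<theta>" \<theta>] by simp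
  finally show ?thesis by simp
qed

lemma reflect_plane_vec: "reflect (simple t) (plane_vec \<phi>) = plane_vec' (\<phi> + \<theta>)"
proof -
  have "bil (simple t) (plane_vec \<phi>) = sin \<phi> - cos \<theta> * sin (\<phi> + \<theta>)"
    by (simp add: plane_vec_def bil_simps bil_st bil_simple_self t)
  then have "reflect (simple t) (plane_vec \<phi>) = sin (\<phi> + \<theta>) *\<^sub>R simple s
      + (2 * cos \<theta> * sin (\<phi> + \<theta>) - sin \<phi>) *\<^sub>R simple t"
    by (simp only: reflect_def) (simp add: plane_vec_def fun_eq_iff algebra_simps)
  then show ?thesis
    unfolding sin_recursion by (simp add: plane_vec'_def add.assoc add.commute[of "_ *\<^sub>R simple t"] flip: mult_2)
qed

lemma reflect_plane_vec': "reflect (simple s) (plane_vec' \<phi>) = plane_vec (\<phi> + \<theta>)"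
proof -
  have "bil (simple s) (plane_vec' \<phi>) = sin \<phi> - cos \<theta> * sin (\<phi> + \<theta>)"
    by (simp add: plane_vec'_def bil_simps bil_st bil_simple_self s)
  then have "reflect (simple s) (plane_vec' \<phi>) = sin (\<phi> + \<theta>) *\<^sub>R simple t
      + (2 * cos \<theta> * sin (\<phi> + \<theta>) - sin \<phi>) *\<^sub>R simple s"
    by (simp only: reflect_def) (simp add: plane_vec'_def fun_eq_iff algebra_simps)
  then show ?thesis
    unfolding sin_recursion by (simp add: plane_vec_def add.assoc add.commute[of "_ *\<^sub>R simple t"] flip: mult_2)
qed

lemma rotation_pow_plane_vec:
  "((reflect (simple s) \<circ> reflect (simple t)) ^^ k) (plane_vec \<phi>) = plane_vec (\<phi> + 2 * real k * \<theta>)"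
  by (induction k) (auto simp: reflect_plane_vec reflect_plane_vec' algebra_simps)

text \<open>The product of the two reflections turns their plane by 2 \<theta>, so the power is
  trivial there. Vectors orthogonal to both roots are fixed, and as sin \<theta> is nonzero every
  vector splits into these two kinds.\<close>

lemma rotation_pow_order:
  "(reflect (simple s) \<circ> reflect (simple t)) ^^ coxeter_order s t = id"
proof -
  define q where "q = reflect (simple s) \<circ> reflect (simple t)"
  define n where "n = coxeter_order s t"
  have lin: "linear q" unfolding q_def by (intro linear_compose linear_reflect)
  have linp: "linear (q ^^ k)" for k
  proof (induction k)
    case (Suc k)
    then show ?case using linear_compose[OF Suc lin] by (simp add: comp_def)
  qed (simp add: linear_id[unfolded id_def] id_def)
  have "n \<ge> 2" unfolding n_def using s t st by (rule coxeter_order_ge_2)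
  then have n: "2 * real n * \<theta> = 2 * pi" by (simp add: \<theta> n_def)
  have "plane_vec (\<phi> + 2 * pi) = plane_vec \<phi>" for \<phi>
    using sin_periodic[of "\<phi> + \<theta>"] sin_periodic[of \<phi>] unfolding plane_vec_def
    by (simp only: add.assoc add.commute[of \<theta>])
  then have plane: "(q ^^ n) (plane_vec \<phi>) = plane_vec \<phi>" for \<phi>
    using rotation_pow_plane_vec[of n \<phi>] n by (simp add: q_def)
  have sn: "sin \<theta> \<noteq> 0" using sin_theta_pos by simp
  have es: "simple s = (1 / sin \<theta>) *\<^sub>R plane_vec 0"
    using sn by (simp add: plane_vec_def)
  have et: "simple t = (- 1 / sin \<theta>) *\<^sub>R plane_vec (- \<theta>)"
    using sn by (simp add: plane_vec_def)
  have qs: "(q ^^ n) (simple s) = simple s"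
    by (subst es, subst linear_scale[OF linp], subst plane) (simp add: es)
  have qt: "(q ^^ n) (simple t) = simple t"
    by (subst et, subst linear_scale[OF linp], subst plane) (simp add: et)
  have "(q ^^ n) x = x" for x
  proof -
    define u v where "u = bil (simple s) x" and "v = bil (simple t) x"
    \<comment> \<open>Cramer's rule for the orthogonal projection of \<open>x\<close> to the plane;
      the Gram determinant is the square of sin \<theta>.\<close>
    define \<alpha> \<beta> where "\<alpha> = (u + cos \<theta> * v) / (sin \<theta>)\<^sup>2" and "\<beta> = (v + cos \<theta> * u) / (sin \<theta>)\<^sup>2"
    define p where "p = x - \<alpha> *\<^sub>R simple s - \<beta> *\<^sub>R simple t"
    have c: "(cos \<theta>)\<^sup>2 = 1 - (sin \<theta>)\<^sup>2" by (rule cos_squared_eq)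
    have "\<alpha> - cos \<theta> * \<beta> = u * (1 - (cos \<theta>)\<^sup>2) / (sin \<theta>)\<^sup>2"
      by (simp add: \<alpha>_def \<beta>_def power2_eq_square divide_simps) (simp add: algebra_simps)
    then have 1: "\<alpha> - cos \<theta> * \<beta> = u" using sn c by simp
    have "\<beta> - cos \<theta> * \<alpha> = v * (1 - (cos \<theta>)\<^sup>2) / (sin \<theta>)\<^sup>2"
      by (simp add: \<alpha>_def \<beta>_def power2_eq_square divide_simps) (simp add: algebra_simps)
    then have 2: "\<beta> - cos \<theta> * \<alpha> = v" using sn c by simp
    have "bil (simple s) p = 0" "bil (simple t) p = 0"
      using 1 2 by (auto simp: p_def bil_simps bil_st bil_simple_self s t u_def v_def algebra_simps)
    then have "q p = p" by (simp add: q_def reflect_def)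
    then have qp: "(q ^^ n) p = p" by (induction n) auto
    have x: "x = p + \<alpha> *\<^sub>R simple s + \<beta> *\<^sub>R simple t" by (simp add: p_def)
    show ?thesis
      by (subst x, simp only: linear_add[OF linp] linear_scale[OF linp] qp qs qt) (simp add: x)
  qed
  then show ?thesis by (simp add: q_def n_def fun_eq_iff)
qed

end

section \<open>The action of the Coxeter group\<close>

lemma coxeter_relation_reflect:
  assumes "s \<in> S" "t \<in> S"
  shows "(reflect (simple s) \<circ> reflect (simple t)) ^^ coxeter_order s t = id"
proof (cases "s = t")
  case True
  then show ?thesis using assms by (auto simp: coxeter_order_self reflect_reflect bil_simple_self)
next
  case False
  then show ?thesis using assms rotation_pow_order by blast
qed

text \<open>This serves twice: for the geometric representation \<open>act\<close>, and later for
  the homomorphism \<open>lift\<close> into the group with the dual presentation.\<close>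

lemma coxeter_hom_extend:
  assumes "group H" "f \<in> S \<rightarrow> carrier H"
    and "\<And>s t. s \<in> S \<Longrightarrow> t \<in> S \<Longrightarrow> (f s \<otimes>\<^bsub>H\<^esub> f t) [^]\<^bsub>H\<^esub> coxeter_order s t = \<one>\<^bsub>H\<^esub>"
  shows "\<exists>h\<in>hom W H. \<forall>s\<in>S. h s = f s"
proof (rule has_presentation_extend[OF is_group _ assms(1,2)])
  show "has_presentation W S (coxeter_relations W S)"
    using coxeter by (simp add: coxeter_system_def)
next
  interpret H: group H by fact
  fix u v assume "(u, v) \<in> coxeter_relations W S"
  then obtain s t where st: "s \<in> S" "t \<in> S" "v = []"
    "u = positive (concat (replicate (coxeter_order s t) [s, t]))"
    by (auto simp: coxeter_relations_def coxeter_order_def)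
  have "f s \<in> carrier H" "f t \<in> carrier H" using st assms(2) by auto
  then show "word_eval H f u = word_eval H f v"
    using H.list_product_concat_replicate[of "[f s, f t]" "coxeter_order s t"] assms(3) st
    by (simp add: word_eval_positive map_concat)
qed

definition act :: "'a \<Rightarrow> ('a \<Rightarrow> real) \<Rightarrow> ('a \<Rightarrow> real)" where
  "act = (SOME h. h \<in> hom W general_linear_group \<and> (\<forall>s\<in>S. h s = reflect (simple s)))"

lemma act: "act \<in> hom W general_linear_group" "s \<in> S \<Longrightarrow> act s = reflect (simple s)"
proof -
  let ?P = "\<lambda>h. h \<in> hom W general_linear_group \<and> (\<forall>s\<in>S. h s = reflect (simple s))"
  have "\<exists>h\<in>hom W general_linear_group. \<forall>s\<in>S. h s = reflect (simple s)"
  proof (rule coxeter_hom_extend[OF group_general_linear_group])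
    show "(\<lambda>s. reflect (simple s)) \<in> S \<rightarrow> carrier general_linear_group"
      by (auto intro: reflect_in_general_linear_group bil_simple_self)
  next
    fix s t assume "s \<in> S" "t \<in> S"
    from coxeter_relation_reflect[OF this]
    show "(reflect (simple s) \<otimes>\<^bsub>general_linear_group\<^esub> reflect (simple t))
        [^]\<^bsub>general_linear_group\<^esub> coxeter_order s t = \<one>\<^bsub>general_linear_group\<^esub>"
      unfolding general_linear_group_pow by (simp add: general_linear_group_def)
  qed
  then have "\<exists>h. ?P h" by blast
  then have "?P act" unfolding act_def by (rule someI_ex[of ?P])
  then show "act \<in> hom W general_linear_group" "s \<in> S \<Longrightarrow> act s = reflect (simple s)" by blast+
qed

lemma act_mult: "v \<in> carrier W \<Longrightarrow> w \<in> carrier W \<Longrightarrow> act (v \<otimes> w) x = act v (act w x)"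
  using act(1) by (auto simp: hom_def general_linear_group_def)

lemma act_one [simp]: "act \<one> x = x"
  using hom_one[OF act(1) is_group group_general_linear_group]
  by (simp add: general_linear_group_def)

lemma linear_act: "w \<in> carrier W \<Longrightarrow> linear (act w)"
  using act(1) by (auto simp: hom_def general_linear_group_def)

lemma act_inv [simp]:
  "w \<in> carrier W \<Longrightarrow> act (inv w) (act w x) = x"
  "w \<in> carrier W \<Longrightarrow> act w (act (inv w) x) = x"
  by (simp_all flip: act_mult)

lemma act_minus: "w \<in> carrier W \<Longrightarrow> act w (- x) = - act w x"
  by (rule linear_neg[OF linear_act])

text \<open>The letters are involutions, so formal inverses can be replaced by the letters
  themselves.\<close>

lemma S_words:
  assumes "w \<in> carrier W"
  shows "\<exists>xs. set xs \<subseteq> S \<and> w = list_product W xs"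
proof -
  have "has_presentation W S (coxeter_relations W S)"
    using coxeter by (simp add: coxeter_system_def)
  from has_presentation_words[OF is_group this assms]
  obtain u where u: "u \<in> lists (S \<times> UNIV)" "w = word_eval W (\<lambda>s. s) u" by blast
  from u(1) have "word_eval W (\<lambda>s. s) u = list_product W (map fst u) \<and> set (map fst u) \<subseteq> S"
    by (induction u) (auto simp: S_inv)
  then show ?thesis using u(2) by blast
qed

lemma list_product_S_closed [simp]: "set xs \<subseteq> S \<Longrightarrow> list_product W xs \<in> carrier W"
  using S_carrier by (intro list_product_closed) auto

lemma carrier_induct [consumes 1, case_names one step]:
  assumes "w \<in> carrier W" "P \<one>"
    and "\<And>s w. s \<in> S \<Longrightarrow> w \<in> carrier W \<Longrightarrow> P w \<Longrightarrow> P (s \<otimes> w)"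
  shows "P w"
proof -
  obtain xs where xs: "set xs \<subseteq> S" "w = list_product W xs" using S_words[OF assms(1)] by blast
  have "P (list_product W xs)" using xs(1)
    by (induction xs) (use assms(2,3) in auto)
  then show ?thesis using xs(2) by simp
qed

lemma bil_act: "w \<in> carrier W \<Longrightarrow> bil (act w x) (act w y) = bil x y"
  by (induction arbitrary: x y rule: carrier_induct)
    (auto simp: act_mult act(2) bil_reflect bil_simple_self)

lemma act_support:
  assumes "w \<in> carrier W" "r \<notin> S"
  shows "act w x r = x r"
  using assms(1)
proof (induction rule: carrier_induct)
  case (step s w)
  then have "r \<noteq> s" using assms(2) by auto
  then show ?case using step by (simp add: act_mult act(2) reflect_simple_other)
qed simp

end

section \<open>Length and positivity of roots\<close>

context finite_coxeter_group
begin

section \<open>Word length with respect to the simple reflections\<close>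

definition len :: "'a \<Rightarrow> nat" where
  "len w = (LEAST n. \<exists>xs. set xs \<subseteq> S \<and> length xs = n \<and> list_product W xs = w)"

lemma len_word:
  assumes "w \<in> carrier W"
  obtains xs where "set xs \<subseteq> S" "length xs = len w" "list_product W xs = w"
proof -
  have "\<exists>n xs. set xs \<subseteq> S \<and> length xs = n \<and> list_product W xs = w"
    using S_words[OF assms] by auto
  from LeastI_ex[OF this] show ?thesis using that by (auto simp: len_def)
qed

lemma len_le: "set xs \<subseteq> S \<Longrightarrow> len (list_product W xs) \<le> length xs"
  unfolding len_def by (rule Least_le) auto

lemma len_mult:
  assumes "v \<in> carrier W" "w \<in> carrier W"
  shows "len (v \<otimes> w) \<le> len v + len w"
proof -
  obtain xs where xs: "set xs \<subseteq> S" "length xs = len v" "list_product W xs = v"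
    using len_word[OF assms(1)] by blast
  obtain ys where ys: "set ys \<subseteq> S" "length ys = len w" "list_product W ys = w"
    using len_word[OF assms(2)] by blast
  have "set xs \<subseteq> carrier W" "set ys \<subseteq> carrier W" using xs ys S_carrier by auto
  then show ?thesis using len_le[of "xs @ ys"] xs ys by simp
qed

lemma len_simple: "s \<in> S \<Longrightarrow> len s \<le> 1"
  using len_le[of "[s]"] by simp

lemma len_one [simp]: "len \<one> = 0"
  using len_le[of "[]"] by simp

lemma len_mult_simple: "w \<in> carrier W \<Longrightarrow> s \<in> S \<Longrightarrow> len (w \<otimes> s) \<le> len w + 1"
  using len_mult[of w s] len_simple[of s] by auto

lemma len_le_mult_simple: "w \<in> carrier W \<Longrightarrow> s \<in> S \<Longrightarrow> len w \<le> len (w \<otimes> s) + 1"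
  using len_mult_simple[of "w \<otimes> s" s] by simp

lemma inv_list_product_S: "set xs \<subseteq> S \<Longrightarrow> inv (list_product W xs) = list_product W (rev xs)"
proof (induction xs)
  case (Cons x xs)
  then have "set (rev xs) \<subseteq> carrier W" "x \<in> carrier W" using S_carrier by auto
  then show ?case using Cons by (simp add: inv_mult_group S_inv)
qed simp

lemma len_inv_le:
  assumes "w \<in> carrier W"
  shows "len (inv w) \<le> len w"
proof -
  obtain xs where xs: "set xs \<subseteq> S" "length xs = len w" "list_product W xs = w"
    using len_word[OF assms] by blast
  then show ?thesis using len_le[of "rev xs"] inv_list_product_S[of xs] by simp
qed

lemma ex_descent:
  assumes "w \<in> carrier W" "w \<noteq> \<one>"
  obtains s where "s \<in> S" "len (w \<otimes> s) < len w"
proof -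
  obtain xs where xs: "set xs \<subseteq> S" "length xs = len w" "list_product W xs = w"
    using len_word[OF assms(1)] by blast
  then have "xs \<noteq> []" using assms(2) by auto
  then obtain ys s where ys: "xs = ys @ [s]" by (meson rev_exhaust)
  then have "set ys \<subseteq> carrier W" "s \<in> S" "set ys \<subseteq> S" using xs S_carrier by auto
  then have "w \<otimes> s = list_product W ys" using xs(3) ys by auto
  then have "len (w \<otimes> s) < len w" using len_le[OF \<open>set ys \<subseteq> S\<close>] xs(2) ys by simp
  then show ?thesis using that \<open>s \<in> S\<close> by blast
qed

text \<open>The rightmost of the \<open>j\<close> letters is \<open>t\<close>.\<close>

primrec alternating :: "'a \<Rightarrow> 'a \<Rightarrow> nat \<Rightarrow> 'a" where
  "alternating s t 0 = \<one>"
| "alternating s t (Suc j) = (if even j then t else s) \<otimes> alternating s t j"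

lemma alternating_closed [simp]: "s \<in> S \<Longrightarrow> t \<in> S \<Longrightarrow> alternating s t j \<in> carrier W"
  by (induction j) auto

lemma alternating_append:
  "s \<in> S \<Longrightarrow> t \<in> S \<Longrightarrow> alternating s t j \<otimes> s = alternating t s (Suc j)"
  by (induction j) (auto simp: m_assoc)

lemma alternating_split:
  assumes "s \<in> S" "t \<in> S" "k \<le> n"
  obtains u where "u \<in> carrier W" "len u \<le> n - k" "alternating s t n = u \<otimes> alternating s t k"
proof -
  have "\<exists>u\<in>carrier W. len u \<le> n - k \<and> alternating s t n = u \<otimes> alternating s t k"
    using assms(3)
  proof (induction n rule: dec_induct)
    case base
    show ?case by (rule bexI[of _ \<one>]) (use assms in auto)
  next
    case (step n)
    let ?a = "if even n then t else s"
    have a: "?a \<in> S" using assms by auto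
    obtain u where u: "u \<in> carrier W" "len u \<le> n - k" "alternating s t n = u \<otimes> alternating s t k"
      using step.IH by blast
    have "len (?a \<otimes> u) \<le> Suc n - k"
      using len_mult[of ?a u] len_simple[OF a] a u step.hyps by auto
    moreover have "alternating s t (Suc n) = (?a \<otimes> u) \<otimes> alternating s t k"
      using u a assms by (simp add: m_assoc)
    ultimately show ?case using u(1) a by blast
  qed
  then show ?thesis using that by blast
qed

lemma alternating_even: "s \<in> S \<Longrightarrow> t \<in> S \<Longrightarrow> alternating s t (2 * i) = (s \<otimes> t) [^] i"
proof (induction i)
  case (Suc i)
  then show ?case using nat_pow_Suc2[of "s \<otimes> t" i] by (simp add: m_assoc)
qed simp

lemma alternating_short:
  assumes "s \<in> S" "t \<in> S" "s \<noteq> t" "coxeter_order s t < k"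
  shows "len (alternating s t k) + 2 \<le> k"
proof -
  let ?m = "coxeter_order s t"
  have m: "?m \<ge> 2" using assms(1-3) by (rule coxeter_order_ge_2)
  have one: "alternating s t (2 * ?m) = \<one>"
    using assms(1,2) by (simp add: alternating_even coxeter_order_def)
  show ?thesis
  proof (cases "k \<le> 2 * ?m")
    case True
    then obtain u where u: "u \<in> carrier W" "len u \<le> 2 * ?m - k"
      "alternating s t (2 * ?m) = u \<otimes> alternating s t k"
      using alternating_split[OF assms(1,2)] by blast
    have "inv (alternating s t k) = u"
      using u(1,3) one assms(1,2) by (intro inv_equality) auto
    then have "alternating s t k = inv u" using assms(1,2) by auto
    then show ?thesis using len_inv_le[OF u(1)] u(2) True assms(4) by auto
  next
    case False
    then obtain u where u: "u \<in> carrier W" "len u \<le> k - 2 * ?m"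
      "alternating s t k = u \<otimes> alternating s t (2 * ?m)"
      using alternating_split[OF assms(1,2), of "2 * ?m" k] by auto
    then show ?thesis using one m False by auto
  qed
qed

lemma act_alternating:
  assumes "s \<in> S" "t \<in> S" "s \<noteq> t" and \<theta>: "\<theta> = pi / real (coxeter_order s t)"
  shows "act (alternating s t j) (plane_vec s t \<theta> 0) =
    (if even j then plane_vec s t \<theta> (real j * \<theta>) else plane_vec' s t \<theta> (real j * \<theta>))"
proof (induction j)
  case (Suc j)
  then show ?case
    using assms(1,2) reflect_plane_vec[OF assms] reflect_plane_vec'[OF assms]
    by (auto simp: act_mult act(2) algebra_simps)
qed simp

definition nonneg :: "('a \<Rightarrow> real) \<Rightarrow> bool" where
  "nonneg x \<longleftrightarrow> (\<forall>r. 0 \<le> x r)"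

lemma nonneg_simple: "nonneg (simple s)"
  by (simp add: nonneg_def simple_apply)

text \<open>Each letter advances the angle by \<theta>. The coefficients are the sines of j \<theta>
  and (j + 1) \<theta>, divided by sin \<theta>; neither angle exceeds \<pi> as \<open>j\<close> is
  below the order.\<close>

lemma act_alternating_simple:
  assumes "s \<in> S" "t \<in> S" "s \<noteq> t" "j < coxeter_order s t"
  obtains a b where "a \<ge> 0" "b \<ge> 0"
    "act (alternating s t j) (simple s) = a *\<^sub>R simple s + b *\<^sub>R simple t"
proof -
  define \<theta> where \<theta>: "\<theta> = pi / real (coxeter_order s t)"
  note ctx = assms(1-3) \<theta>
  have sp: "sin \<theta> > 0" using sin_theta_pos[OF ctx] .
  have bound: "0 \<le> sin (real i * \<theta>)" if "i \<le> coxeter_order s t" for i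
  proof (rule sin_ge_zero)
    show "0 \<le> real i * \<theta>" by (simp add: \<theta>)
    show "real i * \<theta> \<le> pi" using that assms(4) by (simp add: \<theta> field_simps)
  qed
  define f where "f i = sin (real i * \<theta>) / sin \<theta>" for i
  have f: "0 \<le> f j" "0 \<le> f (Suc j)" using bound[of j] bound[of "Suc j"] sp assms(4) by (auto simp: f_def)
  have "simple s = (1 / sin \<theta>) *\<^sub>R plane_vec s t \<theta> 0"
    using sp by (simp add: plane_vec_def[OF ctx])
  then have "act (alternating s t j) (simple s)
      = (1 / sin \<theta>) *\<^sub>R act (alternating s t j) (plane_vec s t \<theta> 0)"
    using linear_scale[OF linear_act[OF alternating_closed[OF assms(1,2)]]] by metis
  then have eq: "act (alternating s t j) (simple s) =
      (if even j then f (Suc j) *\<^sub>R simple s + f j *\<^sub>R simple t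
       else f j *\<^sub>R simple s + f (Suc j) *\<^sub>R simple t)"
    unfolding act_alternating[OF ctx]
    by (simp add: plane_vec_def[OF ctx] plane_vec'_def[OF ctx] f_def algebra_simps)
  show ?thesis
  proof (cases "even j")
    case True
    then show ?thesis using that[OF f(2,1)] eq by simp
  next
    case False
    then show ?thesis using that[OF f] eq by simp
  qed
qed

text \<open>Write \<open>w = v p\<close> with \<open>p\<close> alternating in \<open>s\<close> and a right descent \<open>t\<close> of \<open>w\<close>, and with \<open>p\<close> as
  long as possible. Then \<open>v\<close> has neither \<open>s\<close> nor \<open>t\<close> as a right descent, and \<open>p\<close> is too short to
  make the root of \<open>s\<close> negative.\<close>

lemma nonneg_if_not_descent:
  assumes "w \<in> carrier W" "s \<in> S" "\<not> len (w \<otimes> s) < len w"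
  shows "nonneg (act w (simple s))"
  using assms
proof (induction "len w" arbitrary: w s rule: less_induct)
  case less
  note s = less.prems(2)
  show ?case
  proof (cases "w = \<one>")
    case True
    then show ?thesis by (simp add: nonneg_simple)
  next
    case False
    then obtain t where t: "t \<in> S" "len (w \<otimes> t) < len w" using ex_descent[OF less.prems(1)] by blast
    have st: "s \<noteq> t" using t less.prems by auto
    define P where "P j \<longleftrightarrow> (\<exists>v\<in>carrier W. w = v \<otimes> alternating s t j \<and> len w = len v + j)" for j
    have "P 1"
      unfolding P_def
    proof (rule bexI[of _ "w \<otimes> t"])
      show "w = w \<otimes> t \<otimes> alternating s t 1 \<and> len w = len (w \<otimes> t) + 1"
        using t less.prems len_le_mult_simple[of w t] by auto
    qed (use t less.prems in auto)
    have bnd: "\<forall>k. P k \<longrightarrow> k \<le> len w" by (auto simp: P_def)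
    define j where "j = Greatest P"
    have Pj: "P j" unfolding j_def using GreatestI_nat[of P 1 "len w"] \<open>P 1\<close> bnd by blast
    have max: "k \<le> j" if "P k" for k unfolding j_def using Greatest_le_nat[of P k "len w"] that bnd by blast
    obtain v where v: "v \<in> carrier W" "w = v \<otimes> alternating s t j" "len w = len v + j"
      using Pj by (auto simp: P_def)
    obtain i where i: "j = Suc i" using max[OF \<open>P 1\<close>] by (cases j) auto
    \<comment> \<open>\<open>a\<close> is the leftmost letter of the alternating word and
      \<open>b\<close> the letter that would precede it. A shorter \<open>v \<otimes> b\<close>
      would extend the alternating part against maximality; a shorter \<open>v \<otimes> a\<close>
      would give too short a word for \<open>w\<close>.\<close>
    define a where "a = (if even i then t else s)"
    define b where "b = (if even j then t else s)"
    have ab: "a \<in> S" "b \<in> S" using s t by (auto simp: a_def b_def)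
    have nb: "\<not> len (v \<otimes> b) < len v"
    proof
      assume lt: "len (v \<otimes> b) < len v"
      have "w = (v \<otimes> b) \<otimes> alternating s t (Suc j)"
        using v ab s t by (simp add: b_def[symmetric] m_assoc)
      moreover have "len (alternating s t (Suc j)) \<le> Suc j"
        using alternating_split[OF s t(1), of 0 "Suc j"]
        by (metis alternating.simps(1) diff_zero le0 r_one)
      ultimately have "P (Suc j)"
        unfolding P_def using v(1,3) ab lt len_mult[of "v \<otimes> b" "alternating s t (Suc j)"] s t
        by (intro bexI[of _ "v \<otimes> b"]) auto
      then show False using max[of "Suc j"] by simp
    qed
    have na: "\<not> len (v \<otimes> a) < len v"
    proof
      assume lt: "len (v \<otimes> a) < len v"
      have "w = (v \<otimes> a) \<otimes> alternating s t i"
        using v ab s t by (simp add: i a_def[symmetric] m_assoc)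
      moreover have "len (alternating s t i) \<le> i"
        using alternating_split[OF s t(1), of 0 i]
        by (metis alternating.simps(1) diff_zero le0 r_one)
      ultimately show False
        using len_mult[of "v \<otimes> a" "alternating s t i"] v(1,3) ab lt s t i by auto
    qed
    have st_ab: "{s, t} = {a, b}" using i by (auto simp: a_def b_def)
    have lv: "len v < len w" using v i by simp
    have nn: "nonneg (act v (simple s))" "nonneg (act v (simple t))"
      using less.hyps[OF lv v(1) ab(1) na] less.hyps[OF lv v(1) ab(2) nb] st_ab
      by (auto simp: doubleton_eq_iff)
    \<comment> \<open>Otherwise \<open>w \<otimes> s\<close> is \<open>v\<close> times an
      alternating word with more letters than the order; that word shortens by two, which makes
      \<open>s\<close> a descent of \<open>w\<close>.\<close>
    have "j < coxeter_order s t"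
    proof (rule ccontr)
      assume "\<not> j < coxeter_order s t"
      then have "len (alternating t s (Suc j)) + 2 \<le> Suc j"
        using alternating_short[of t s "Suc j"] s t st coxeter_order_commute[of s t] by auto
      moreover have "w \<otimes> s = v \<otimes> alternating t s (Suc j)"
        using v s t alternating_append[of s t j] by (simp add: m_assoc)
      moreover have "len (v \<otimes> alternating t s (Suc j)) \<le> len v + len (alternating t s (Suc j))"
        by (rule len_mult[OF v(1) alternating_closed[OF t(1) s]])
      ultimately have "len (w \<otimes> s) < len w" using v(3) by simp
      then show False using less.prems by simp
    qed
    then obtain p q where pq: "p \<ge> 0" "q \<ge> 0"
      "act (alternating s t j) (simple s) = p *\<^sub>R simple s + q *\<^sub>R simple t"
      using act_alternating_simple[OF s t(1) st] by blast
    have "act w (simple s) = p *\<^sub>R act v (simple s) + q *\<^sub>R act v (simple t)"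
      using v s t pq(3) linear_act[OF v(1)] by (simp add: act_mult linear_add linear_scale)
    then show ?thesis using nn pq by (simp add: nonneg_def)
  qed
qed

lemma nonpos_if_descent:
  assumes "w \<in> carrier W" "s \<in> S" "len (w \<otimes> s) < len w"
  shows "nonneg (- act w (simple s))"
proof -
  have "nonneg (act (w \<otimes> s) (simple s))"
    using assms by (intro nonneg_if_not_descent) auto
  then show ?thesis
    using assms by (simp add: act_mult act(2) reflect_self bil_simple_self act_minus)
qed

section \<open>Roots and their signs\<close>

definition root :: "('a \<Rightarrow> real) \<Rightarrow> bool" where
  "root x \<longleftrightarrow> (\<exists>w\<in>carrier W. \<exists>s\<in>S. x = act w (simple s))"

lemma root_simple: "s \<in> S \<Longrightarrow> root (simple s)"
  unfolding root_def by (rule bexI[of _ \<one>]) auto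

lemma root_act: "w \<in> carrier W \<Longrightarrow> root x \<Longrightarrow> root (act w x)"
  unfolding root_def by (metis act_mult m_closed)

lemma bil_root: "root x \<Longrightarrow> bil x x = 1"
  by (auto simp: root_def bil_act bil_simple_self)

lemma root_pos_neg: "root x \<Longrightarrow> nonneg x \<or> nonneg (- x)"
  unfolding root_def using nonneg_if_not_descent nonpos_if_descent by blast

lemma root_not_both:
  assumes "root x" "nonneg x"
  shows "\<not> nonneg (- x)"
proof
  assume "nonneg (- x)"
  then have "x r = 0" for r using assms(2) by (auto simp: nonneg_def intro: antisym)
  then show False using bil_root[OF assms(1)] by (simp add: bil_def)
qed

lemma root_support: "root x \<Longrightarrow> r \<notin> S \<Longrightarrow> x r = 0"
  by (auto simp: root_def act_support simple_apply)

text \<open>A nontrivial element has a right descent, and it makes the corresponding simple root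
  negative instead of fixing it.\<close>

lemma act_faithful:
  assumes "w \<in> carrier W" "\<And>s. s \<in> S \<Longrightarrow> act w (simple s) = simple s"
  shows "w = \<one>"
proof (rule ccontr)
  assume "w \<noteq> \<one>"
  then obtain s where "s \<in> S" "len (w \<otimes> s) < len w" using ex_descent[OF assms(1)] by blast
  then have "nonneg (- simple s)" using nonpos_if_descent[OF assms(1)] assms(2) by metis
  then show False using root_not_both[OF root_simple nonneg_simple] \<open>s \<in> S\<close> by blast
qed

lemma act_inject:
  assumes "v \<in> carrier W" "w \<in> carrier W" "\<And>x. act v x = act w x"
  shows "v = w"
proof -
  have "inv v \<otimes> w = \<one>"
    using assms by (intro act_faithful) (auto simp: act_mult simp flip: assms(3))
  then show ?thesis using assms(1,2) by (metis inv_closed inv_equality inv_inv)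
qed

lemma act_conjugate:
  assumes "w \<in> carrier W" "t \<in> carrier W" "\<And>x. act t x = reflect b x"
  shows "act (w \<otimes> t \<otimes> inv w) x = reflect (act w b) x"
proof -
  have "bil b (act (inv w) x) = bil (act w b) x"
    using bil_act[OF assms(1), of b "act (inv w) x"] assms(1) by simp
  then show ?thesis
    using assms linear_act[OF assms(1)]
    by (simp add: act_mult m_assoc reflect_def linear_diff linear_scale)
qed

lemma reflect_uminus: "reflect (- b) x = reflect b x"
  using bil_scale_left[of "-1" b x] by (simp add: reflect_def)

text \<open>A simple reflection alters only one coordinate. If the sign of the root changes, all
  other coordinates vanish, and norm 1 leaves just the simple root.\<close>

lemma nonneg_reflect_simple:
  assumes "root x" "nonneg x" "s \<in> S" "\<not> nonneg (reflect (simple s) x)"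
  shows "x = simple s"
proof -
  have "root (reflect (simple s) x)" using root_act[of s x] assms by (simp add: act(2))
  then have neg: "nonneg (- reflect (simple s) x)" using root_pos_neg assms(4) by blast
  have "x r = 0" if "r \<noteq> s" for r
  proof -
    have "0 \<le> (- reflect (simple s) x) r" "0 \<le> x r"
      using neg assms(2) unfolding nonneg_def by blast+
    then show ?thesis using reflect_simple_other[OF that, of x] by simp
  qed
  then have x: "x = x s *\<^sub>R simple s" by (auto simp: fun_eq_iff simple_apply)
  have "1 = bil (x s *\<^sub>R simple s) (x s *\<^sub>R simple s)" using bil_root[OF assms(1)] x by simp
  then have "x s * x s = 1" using assms(3) by (simp add: bil_simps bil_simple_self)
  moreover have "x s \<ge> 0" using assms(2) by (simp add: nonneg_def)
  ultimately have "x s = 1" using power2_eq_1_iff[of "x s"] by (auto simp: power2_eq_square)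
  then show ?thesis using x by simp
qed

text \<open>The letters act from the right end of the list. At some letter the root turns from
  positive to negative, and there it must be the simple root of that letter.\<close>

lemma inversion_suffix:
  assumes "set xs \<subseteq> S" "root x" "nonneg x" "\<not> nonneg (act (list_product W xs) x)"
  shows "\<exists>as s bs. xs = as @ s # bs \<and> act (list_product W bs) x = simple s"
  using assms
proof (induction xs)
  case (Cons a xs)
  show ?case
  proof (cases "nonneg (act (list_product W xs) x)")
    case True
    have "\<not> nonneg (reflect (simple a) (act (list_product W xs) x))"
      using Cons.prems by (simp add: act_mult act(2))
    then have "act (list_product W xs) x = simple a"
      using Cons.prems True by (intro nonneg_reflect_simple root_act) auto
    then show ?thesis by blast
  next
    case False
    then obtain as s bs where "xs = as @ s # bs" "act (list_product W bs) x = simple s"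
      using Cons by auto
    then show ?thesis by (intro exI[of _ "a # as"]) auto
  qed
qed simp

section \<open>Fixed vectors\<close>

lemma act_list_product_other:
  "set xs \<subseteq> S \<Longrightarrow> r \<notin> set xs \<Longrightarrow> act (list_product W xs) x r = x r"
  by (induction xs) (auto simp: act_mult act(2) reflect_simple_other)

text \<open>Each letter changes only its own coordinate and no letter occurs twice, so changes
  cannot cancel: a vector fixed by the product is fixed at every stage.\<close>

lemma fixed_by_distinct_product:
  assumes "set xs \<subseteq> S" "distinct xs" "act (list_product W xs) x = x" "s \<in> set xs"
  shows "reflect (simple s) x = x"
  using assms
proof (induction xs)
  case (Cons a xs)
  let ?y = "act (list_product W xs) x"
  have fx: "reflect (simple a) ?y = x" using Cons.prems by (simp add: act_mult act(2))
  have "?y r = x r" for r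
  proof (cases "r = a")
    case True
    then show ?thesis using Cons.prems by (intro act_list_product_other) auto
  next
    case False
    then show ?thesis using reflect_simple_other[OF False, of ?y] fx by simp
  qed
  then have "?y = x" by (simp add: fun_eq_iff)
  then show ?case using Cons fx by auto
qed simp

text \<open>Replacing \<open>w\<close> by \<open>w \<otimes> s\<close> permutes the group and
  negates every summand.\<close>

lemma sum_act_simple:
  assumes "s \<in> S"
  shows "(\<Sum>w\<in>carrier W. act w (simple s)) = 0"
proof -
  let ?z = "\<Sum>w\<in>carrier W. act w (simple s)"
  have "?z = (\<Sum>w\<in>carrier W. act (w \<otimes> s) (simple s))"
    by (rule sum.reindex_bij_witness[where i = "\<lambda>w. w \<otimes> s" and j = "\<lambda>w. w \<otimes> s"])
      (use assms in auto)
  also have "\<dots> = (\<Sum>w\<in>carrier W. - act w (simple s))"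
    using assms
    by (intro sum.cong) (auto simp: act_mult act(2) reflect_self bil_simple_self act_minus)
  also have "\<dots> = - ?z" by (simp add: sum_negf)
  finally have "?z + ?z = 0" by simp
  then show ?thesis by (simp flip: scaleR_2)
qed

text \<open>An invariant vector equals its average over the finite group. Expanded in simple roots,
  that average is a combination of the vanishing sums of \<open>sum_act_simple\<close>.\<close>

lemma invariant_vector_zero:
  assumes "\<And>s. s \<in> S \<Longrightarrow> reflect (simple s) x = x" "\<And>r. r \<notin> S \<Longrightarrow> x r = 0"
  shows "x = 0"
proof -
  have fixed: "act w x = x" if "w \<in> carrier W" for w
    using that by (induction rule: carrier_induct) (auto simp: act_mult act(2) assms(1))
  have x: "x = (\<Sum>s\<in>S. x s *\<^sub>R simple s)"
  proof
    fix r
    have "x s * simple s r = (if s = r then x s else 0)" for s by (simp add: simple_apply)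
    then show "x r = (\<Sum>s\<in>S. x s *\<^sub>R simple s) r"
      using assms(2)[of r] finite_S by simp
  qed
  have "real (card (carrier W)) *\<^sub>R x = (\<Sum>w\<in>carrier W. act w x)"
    by (simp add: fixed sum_constant_scaleR del: sum_constant)
  also have "\<dots> = (\<Sum>w\<in>carrier W. \<Sum>s\<in>S. x s *\<^sub>R act w (simple s))"
  proof (rule sum.cong)
    fix w assume "w \<in> carrier W"
    from linear_act[OF this]
    show "act w x = (\<Sum>s\<in>S. x s *\<^sub>R act w (simple s))"
      by (subst x) (simp add: linear_sum linear_scale)
  qed simp
  also have "\<dots> = (\<Sum>s\<in>S. x s *\<^sub>R (\<Sum>w\<in>carrier W. act w (simple s)))"
    by (subst sum.swap) (simp add: scaleR_sum_right)
  also have "\<dots> = 0" by (simp add: sum_act_simple)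
  finally show ?thesis using finite_carrier one_closed by auto
qed

end

section \<open>Reflections and Coxeter elements\<close>

context finite_coxeter_group
begin

section \<open>Reflections in roots\<close>

lemma root_uminus: "root x \<Longrightarrow> root (- x)"
proof -
  assume "root x"
  then obtain w s where ws: "w \<in> carrier W" "s \<in> S" "x = act w (simple s)" by (auto simp: root_def)
  then have "- x = act (w \<otimes> s) (simple s)"
    by (simp add: act_mult act(2) reflect_self bil_simple_self act_minus)
  then show ?thesis using ws by (auto simp: root_def)
qed

text \<open>The root may have either sign; \<open>reflects_uminus\<close> allows passing to the
  positive one.\<close>

definition reflects :: "'a \<Rightarrow> ('a \<Rightarrow> real) \<Rightarrow> bool" where
  "reflects t x \<longleftrightarrow> t \<in> carrier W \<and> root x \<and> (\<forall>y. act t y = reflect x y)"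

lemma reflects_simple: "s \<in> S \<Longrightarrow> reflects s (simple s)"
  by (simp add: reflects_def root_simple act(2))

lemma reflects_conjugate:
  "g \<in> carrier W \<Longrightarrow> reflects t x \<Longrightarrow> reflects (g \<otimes> t \<otimes> inv g) (act g x)"
  by (simp add: reflects_def root_act act_conjugate)

lemma reflects_uminus: "reflects t x \<Longrightarrow> reflects t (- x)"
  by (simp add: reflects_def root_uminus reflect_uminus)

lemma reflects_unique: "reflects t x \<Longrightarrow> reflects t' x \<Longrightarrow> t = t'"
  by (auto simp: reflects_def intro: act_inject)

lemma reflects_conjugate_simple:
  assumes "reflects t x"
  obtains g s where "g \<in> carrier W" "s \<in> S" "t = g \<otimes> s \<otimes> inv g"
proof -
  obtain g s where gs: "g \<in> carrier W" "s \<in> S" "x = act g (simple s)"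
    using assms by (auto simp: reflects_def root_def)
  then have "t = g \<otimes> s \<otimes> inv g"
    using reflects_unique[OF assms] reflects_conjugate[OF gs(1) reflects_simple[OF gs(2)]] by simp
  then show ?thesis using that gs by blast
qed

lemma act_pow: "w \<in> carrier W \<Longrightarrow> act (w [^] Suc k) x = act w (act (w [^] k) x)"
  using nat_pow_Suc2[of w k] by (simp add: act_mult)

text \<open>If the orbit of a positive root under the Coxeter element \<open>c\<close> stayed positive, then its sum would be a
  nonzero vector fixed by \<open>c\<close>, hence by every simple reflection.\<close>

lemma coxeter_orbit_leaves_positive:
  assumes xs: "set xs = S" "distinct xs" and x: "root x"
  shows "\<exists>k. \<not> nonneg (act (list_product W xs [^] (k::nat)) x)"
proof (rule ccontr)
  let ?c = "list_product W xs"
  assume "\<not> ?thesis"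
  then have nn: "nonneg (act (?c [^] k) x)" for k :: nat by blast
  have c: "?c \<in> carrier W" using xs by simp
  define n where "n = ord ?c"
  have n: "n \<ge> 1" unfolding n_def using ord_ge_1[OF finite_carrier c] .
  define y where "y = (\<Sum>k<n. act (?c [^] k) x)"
  have "act ?c y = (\<Sum>k<n. act (?c [^] Suc k) x)"
    unfolding y_def using linear_sum[OF linear_act[OF c]] by (simp only: act_pow[OF c])
  \<comment> \<open>The sum over exponents 0 to n is split at either end; as \<open>?c [^] n\<close>
    is trivial, applying \<open>?c\<close> only permutes the summands of \<open>y\<close>.\<close>
  moreover have "y + act (?c [^] n) x = act (?c [^] (0::nat)) x + (\<Sum>k<n. act (?c [^] Suc k) x)"
    using sum.lessThan_Suc_shift[of "\<lambda>k. act (?c [^] k) x" n]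
    by (simp only: y_def sum.lessThan_Suc)
  ultimately have cy: "act ?c y = y" using c by (simp add: n_def)
  have "y = 0"
  proof (rule invariant_vector_zero)
    show "reflect (simple s) y = y" if "s \<in> S" for s
      using fixed_by_distinct_product[of xs y s] xs cy that by auto
    show "y r = 0" if "r \<notin> S" for r
      using root_support[OF root_act[OF _ x] that] c by (simp add: y_def)
  qed
  \<comment> \<open>The summand with exponent 0 is \<open>x\<close>, and nonnegative summands are
    bounded by their sum \<open>y\<close>, which is 0.\<close>
  have "x r \<le> 0" for r
  proof -
    have "act (?c [^] (0::nat)) x r \<le> (\<Sum>k<n. act (?c [^] k) x r)"
      using nn n by (intro member_le_sum) (auto simp: nonneg_def)
    also have "\<dots> = y r" by (simp add: y_def)
    finally show ?thesis using \<open>y = 0\<close> by simp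
  qed
  then have "nonneg (- x)" by (simp add: nonneg_def)
  then show False using root_not_both[OF x] nn[of 0] by simp
qed

text \<open>Just before its first negative member, the orbit of a positive root has a positive one
  that the Coxeter element sends to a negative root. By \<open>inversion_suffix\<close>, such a root
  comes from a simple root and a suffix of \<open>xs\<close>.\<close>

lemma reflection_conjugate_under_coxeter:
  assumes xs: "set xs = S" "distinct xs" and t: "reflects t x"
  obtains k :: nat and as s bs where "xs = as @ s # bs"
    "list_product W xs [^] k \<otimes> t \<otimes> inv (list_product W xs [^] k)
      = inv (list_product W bs) \<otimes> s \<otimes> list_product W bs"
proof -
  let ?c = "list_product W xs"
  have c: "?c \<in> carrier W" using xs by simp
  obtain z where z: "reflects t z" "nonneg z"
  proof -
    have "nonneg x \<or> nonneg (- x)" using t root_pos_neg by (simp add: reflects_def)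
    then show ?thesis using that t reflects_uminus[OF t] by blast
  qed
  have rz: "root z" and tc: "t \<in> carrier W" using z by (auto simp: reflects_def)
  define k where "k = (LEAST k::nat. \<not> nonneg (act (?c [^] k) z))"
  have k: "\<not> nonneg (act (?c [^] k) z)"
    unfolding k_def by (rule LeastI_ex[OF coxeter_orbit_leaves_positive[OF xs rz]])
  \<comment> \<open>\<open>k\<close> is positive because \<open>z\<close> is nonnegative. The
    exponent delivered at the end is \<open>i\<close>, where the root has not yet turned
    negative.\<close>
  obtain i where i: "k = Suc i" using k z(2) by (cases k) auto
  have nn: "nonneg (act (?c [^] i) z)"
    using not_less_Least[of i "\<lambda>k. \<not> nonneg (act (?c [^] k) z)"] i unfolding k_def by simp
  have "\<not> nonneg (act ?c (act (?c [^] i) z))" using k act_pow[OF c, of i z] i by simp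
  from inversion_suffix[OF _ root_act[OF _ rz] nn this] xs c
  obtain as s bs where ab: "xs = as @ s # bs" "act (list_product W bs) (act (?c [^] i) z) = simple s"
    by auto
  define p where "p = list_product W bs"
  have sub: "s \<in> S" "set bs \<subseteq> S" using ab xs by auto
  have p: "p \<in> carrier W" using sub by (simp add: p_def)
  define u where "u = ?c [^] i \<otimes> t \<otimes> inv (?c [^] i)"
  have u: "u \<in> carrier W" using c tc by (simp add: u_def)
  have "reflects (p \<otimes> u \<otimes> inv p) (simple s)"
    using reflects_conjugate[OF p reflects_conjugate[OF _ z(1), of "?c [^] i"]] c ab(2)
    by (simp add: u_def p_def)
  then have "p \<otimes> u \<otimes> inv p = s" using reflects_unique reflects_simple[OF sub(1)] by blast
  then have "u = inv p \<otimes> s \<otimes> p" using p u sub(1) by (metis inv_closed inv_solve_left inv_solve_right' m_assoc m_closed)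
  then show ?thesis using that[OF ab(1)] by (simp add: u_def p_def)
qed

text \<open>Induction on length with a descent \<open>s\<close>. If \<open>w\<close> negates the
  root of \<open>s\<close>, then \<open>s\<close> commutes with \<open>w\<close> and is split off;
  otherwise conjugation by \<open>s\<close> shortens \<open>w\<close>. That \<open>w\<close> negates
  all the roots is what makes the factors commute with \<open>w\<close> in
  \<open>reflects_if_in_T\<close>.\<close>

lemma involution_product_of_reflections:
  assumes "w \<in> carrier W" "w \<otimes> w = \<one>"
  shows "\<exists>rs. (\<forall>p\<in>set rs. reflects (fst p) (snd p) \<and> act w (snd p) = - snd p)
    \<and> w = list_product W (map fst rs)"
  using assms
proof (induction "len w" arbitrary: w rule: less_induct)
  case less
  note w = less.prems(1)
  have winv: "inv w = w" using less.prems by (simp add: inv_equality)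
  show ?case
  proof (cases "w = \<one>")
    case True
    then show ?thesis by (intro exI[of _ "[]"]) auto
  next
    case False
    then obtain s where s: "s \<in> S" and lt: "len (w \<otimes> s) < len w" using ex_descent[OF w] by blast
    show ?thesis
    proof (cases "act w (simple s) = - simple s")
      case True
      have "reflects (w \<otimes> s \<otimes> inv w) (- simple s)"
        using reflects_conjugate[OF w reflects_simple[OF s]] True by simp
      then have "w \<otimes> s \<otimes> w = s"
        using reflects_unique reflects_uminus[OF reflects_simple[OF s]] winv by auto
      then have comm: "s \<otimes> w = w \<otimes> s"
        using w s less.prems(2) by (metis S_closed m_assoc m_closed r_one)
      define v where "v = w \<otimes> s"
      have v: "v \<in> carrier W" using w s by (simp add: v_def)
      have wv: "w = s \<otimes> v" "w = v \<otimes> s" using w s by (simp_all add: v_def) (simp flip: comm)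
      have "v \<otimes> v = w \<otimes> (s \<otimes> w) \<otimes> s" using w s by (simp add: v_def m_assoc)
      then have vv: "v \<otimes> v = \<one>"
        unfolding comm using w s less.prems(2) by (simp add: S_square m_assoc[symmetric])
      obtain rs where rs: "\<forall>p\<in>set rs. reflects (fst p) (snd p) \<and> act v (snd p) = - snd p"
        "v = list_product W (map fst rs)"
        using less.hyps[OF _ v vv] lt by (auto simp: v_def)
      have vs: "act v (simple s) = simple s"
        using w s True by (simp add: v_def act_mult act(2) reflect_self bil_simple_self act_minus)
      \<comment> \<open>A vector negated by \<open>v\<close> is orthogonal to
        \<open>simple s\<close>, which \<open>v\<close> fixes. Hence \<open>s\<close> fixes it, and
        \<open>w\<close> negates it as well.\<close>
      have "act w x = - x" if "act v x = - x" for x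
      proof -
        have "bil (simple s) x = bil (simple s) (- x)"
          using bil_act[OF v, of "simple s" x] vs that by simp
        also have "\<dots> = - bil (simple s) x" using bil_scale_right[of "simple s" "-1" x] by simp
        finally have "reflect (simple s) x = x" by (simp add: reflect_def)
        then show ?thesis using that v s by (simp add: wv(2) act_mult act(2))
      qed
      then show ?thesis
        using rs s True wv(1)
        by (intro exI[of _ "(s, simple s) # rs"]) (auto simp: reflects_simple)
    next
      case False
      \<comment> \<open>This positive root differs from \<open>simple s\<close>, so it stays
        positive under \<open>s\<close>. Hence \<open>u = s \<otimes> w\<close> makes the root of
        \<open>s\<close> negative, and \<open>u \<otimes> s\<close> is shorter than
        \<open>u\<close>, which is the inverse of \<open>w \<otimes> s\<close>.\<close>
      define x where "x = - act w (simple s)"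
      have x: "root x" "nonneg x"
        using nonpos_if_descent[OF w s lt] root_uminus[OF root_act[OF w root_simple[OF s]]]
        by (auto simp: x_def)
      have nn: "nonneg (reflect (simple s) x)"
        using nonneg_reflect_simple[OF x s] False by (metis x_def minus_minus)
      define u where "u = s \<otimes> w"
      have u: "u \<in> carrier W" using w s by (simp add: u_def)
      have us: "act u (simple s) = - reflect (simple s) x"
        using w s linear_neg[OF linear_reflect[of "simple s"], of x]
        by (simp add: u_def act_mult act(2) x_def)
      have "len (u \<otimes> s) < len u"
      proof (rule ccontr)
        assume "\<not> ?thesis"
        then have "nonneg (act u (simple s))" by (rule nonneg_if_not_descent[OF u s])
        moreover have "root (act u (simple s))" by (rule root_act[OF u root_simple[OF s]])
        ultimately show False using root_not_both us nn by (metis minus_minus)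
      qed
      moreover have "len u \<le> len (w \<otimes> s)"
        using len_inv_le[of "w \<otimes> s"] w s by (simp add: inv_mult_group S_inv winv u_def)
      moreover define v where "v = u \<otimes> s"
      ultimately have lv: "len v < len w" using lt by simp
      have v: "v \<in> carrier W" using u s by (simp add: v_def)
      have vv: "v \<otimes> v = \<one>"
        using w s less.prems(2) by (simp add: v_def u_def m_assoc S_square) (simp add: m_assoc[symmetric] S_square)
      obtain rs where rs: "\<forall>p\<in>set rs. reflects (fst p) (snd p) \<and> act v (snd p) = - snd p"
        "v = list_product W (map fst rs)"
        using less.hyps[OF lv v vv] by auto
      have ws: "w \<otimes> s = s \<otimes> v" "w = inv s \<otimes> v \<otimes> s"
        using w s by (simp_all add: v_def u_def m_assoc S_inv S_square)
      define rs' where "rs' = map (\<lambda>p. (inv s \<otimes> fst p \<otimes> s, act s (snd p))) rs"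
      have "set (map fst rs) \<subseteq> carrier W" using rs(1) by (auto simp: reflects_def)
      then have "w = list_product W (map (\<lambda>t. inv s \<otimes> t \<otimes> s) (map fst rs))"
        using list_product_conjugate[of s "map fst rs"] rs(2) s ws(2) by simp
      then have "w = list_product W (map fst rs')" by (simp add: rs'_def comp_def)
      moreover have "reflects (inv s \<otimes> t \<otimes> s) (act s y) \<and> act w (act s y) = - act s y"
        if "reflects t y" "act v y = - y" for t y
      proof
        show "reflects (inv s \<otimes> t \<otimes> s) (act s y)"
          using reflects_conjugate[OF _ that(1), of s] s by (simp add: S_inv)
        have "act w (act s y) = act s (act v y)"
          using w s v by (simp add: ws(1) flip: act_mult)
        then show "act w (act s y) = - act s y" using that s by (simp add: act_minus)
      qed
      ultimately show ?thesis using rs(1) by (intro exI[of _ rs']) (auto simp: rs'_def)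
    qed
  qed
qed

section \<open>The number of reflections in a factorization of a Coxeter element\<close>

lemma independent_simple: "independent (simple ` S)"
proof (rule independent_if_scalars_zero)
  fix f y assume "(\<Sum>x\<in>simple ` S. f x *\<^sub>R x) = 0" "y \<in> simple ` S"
  moreover have inj: "inj_on simple S" by (auto simp: inj_on_def simple_def fun_eq_iff split: if_splits)
  ultimately obtain s where s: "s \<in> S" "y = simple s" "(\<Sum>r\<in>S. f (simple r) *\<^sub>R simple r) = 0"
    by (auto simp: sum.reindex)
  have "f (simple r) * simple r s = (if r = s then f (simple r) else 0)" for r
    by (simp add: simple_apply)
  then have "(\<Sum>r\<in>S. f (simple r) *\<^sub>R simple r) s = f (simple s)"
    using s(1) finite_S by simp
  then show "f y = 0" using s by simp
qed (use finite_S in auto)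

text \<open>The map sending x to x minus its image under the Coxeter element takes values in the
  span of the roots of the factors \<open>zs\<close>. It is injective on the span of the simple
  roots, where no nonzero vector is fixed, so that many roots are needed.\<close>

lemma card_le_reflection_factors:
  assumes xs: "set xs = S" "distinct xs" and zs: "\<And>z. z \<in> set zs \<Longrightarrow> \<exists>x. reflects z x"
    and eq: "list_product W zs = list_product W xs"
  shows "card S \<le> length zs"
proof -
  let ?c = "list_product W xs"
  have c: "?c \<in> carrier W" using xs by simp
  obtain \<beta> where \<beta>: "reflects z (\<beta> z)" if "z \<in> set zs" for z using zs by metis
  have "x - act (list_product W ys) x \<in> span (\<beta> ` set zs)" if "set ys \<subseteq> set zs" for x ys
    using that
  proof (induction ys)
    case (Cons y ys)
    have carr: "set (y # ys) \<subseteq> carrier W" using Cons.prems \<beta> by (force simp: reflects_def)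
    let ?x = "act (list_product W ys) x"
    have "act (list_product W (y # ys)) x = reflect (\<beta> y) ?x"
      using carr \<beta>[of y] Cons.prems by (simp add: act_mult reflects_def)
    then have "x - act (list_product W (y # ys)) x = (x - ?x) + (2 * bil (\<beta> y) ?x) *\<^sub>R \<beta> y"
      by (simp add: reflect_def)
    moreover have "x - ?x \<in> span (\<beta> ` set zs)"
      by (rule Cons.IH) (use Cons.prems in auto)
    moreover have "\<beta> y \<in> span (\<beta> ` set zs)"
      using Cons.prems by (intro span_base) auto
    ultimately show ?case by (simp only: span_add span_scale)
  qed (simp add: span_zero)
  from this[of zs] have im: "x - act ?c x \<in> span (\<beta> ` set zs)" for x using eq by simp
  define f where "f x = x - act ?c x" for x
  have lin: "linear f"
    unfolding f_def by (intro linear_compose_sub linear_act c) (simp add: linear_id[unfolded id_def])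
  have "subspace {x::'a \<Rightarrow> real. \<forall>r. r \<notin> S \<longrightarrow> x r = 0}" by (auto simp: subspace_def)
  then have supp: "span (simple ` S) \<subseteq> {x. \<forall>r. r \<notin> S \<longrightarrow> x r = 0}"
    by (intro span_minimal) (auto simp: simple_apply)
  have inj: "inj_on f (span (simple ` S))"
  proof (rule inj_onI)
    fix x y assume xy: "x \<in> span (simple ` S)" "y \<in> span (simple ` S)" "f x = f y"
    have "f (x - y) = 0" using linear_diff[OF lin] xy(3) by simp
    then have "act ?c (x - y) = x - y" by (simp only: f_def right_minus_eq)
    moreover have "x - y \<in> span (simple ` S)" using xy by (intro span_diff)
    ultimately have "x - y = 0"
      using supp fixed_by_distinct_product[of xs "x - y"] xs by (intro invariant_vector_zero) auto
    then show "x = y" by (simp only: right_minus_eq)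
  qed
  have "independent (f ` simple ` S)"
    by (rule linear_independent_injective_image[OF lin independent_simple inj])
  moreover have "f ` simple ` S \<subseteq> span (\<beta> ` set zs)" using im by (auto simp: f_def)
  ultimately have "card (f ` simple ` S) \<le> card (\<beta> ` set zs)"
    using independent_span_bound[of "\<beta> ` set zs" "f ` simple ` S"] by simp
  moreover have "card (f ` simple ` S) = card (simple ` S)"
    by (rule card_image[OF inj_on_subset[OF inj span_superset]])
  moreover have "card (simple ` S) = card S"
    by (rule card_image) (auto simp: inj_on_def simple_def fun_eq_iff split: if_splits)
  moreover have "card (\<beta> ` set zs) \<le> length zs"
    using card_image_le[of "set zs" \<beta>] card_length[of zs] by simp
  ultimately show ?thesis by simp
qed

end

section \<open>Linear reflections of finite order\<close>

text \<open>A basis of the fixed space is completed by a single vector \<open>b\<close>. Modulo the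
  fixed space every vector is a multiple of \<open>b\<close>, so \<open>f\<close> moves it along
  \<open>f b - b\<close>.\<close>

lemma codim_one_vector:
  fixes f :: "'v::real_vector \<Rightarrow> 'v"
  assumes "finite B" "span B = (UNIV :: 'v set)" and lin: "linear f"
    and dim: "dim (UNIV :: 'v set) - dim {v. f v - v = 0} = 1"
  obtains a where "a \<noteq> 0" "\<And>x. \<exists>k. f x = x + k *\<^sub>R a"
proof -
  let ?K = "{v. f v - v = 0}"
  have K: "subspace ?K"
    by (auto simp: subspace_def linear_add[OF lin] linear_scale[OF lin] linear_0[OF lin])
  obtain C where C: "C \<subseteq> ?K" "independent C" "?K \<subseteq> span C"
    using maximal_independent_subset by blast
  obtain D where D: "C \<subseteq> D" "D \<subseteq> UNIV" "independent D" "UNIV \<subseteq> span D"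
    by (rule maximal_independent_subset_extend[OF subset_UNIV C(2)])
  have CK: "span C = ?K" using C(1,3) K by (simp add: span_minimal subset_antisym)
  have "finite D" using independent_span_bound[OF assms(1) D(3)] assms(2) by simp
  moreover have "card D = dim (UNIV :: 'v set)"
    using dim_eq_card[of D UNIV] D by (simp add: top_unique)
  moreover have "span ?K = ?K" using K by (simp only: span_eq_iff)
  then have "card C = dim ?K" using dim_eq_card[of C ?K] CK C(2) by argo
  ultimately have "card (D - C) = 1"
    using dim D(1) by (simp add: card_Diff_subset finite_subset)
  then obtain b where "D - C = {b}" by (rule card_1_singletonE)
  then have D': "D = insert b C" using D(1) by auto
  define a where "a = f b - b"
  have *: "\<exists>k. f x = x + k *\<^sub>R a" for x
  proof -
    obtain k where "x - k *\<^sub>R b \<in> span C" using D(4) D' span_breakdown_eq[of x b C] by auto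
    then have "f (x - k *\<^sub>R b) = x - k *\<^sub>R b" unfolding CK by simp
    then have "f x = x + k *\<^sub>R a"
      by (simp add: a_def linear_diff[OF lin] linear_scale[OF lin] algebra_simps)
    then show ?thesis by blast
  qed
  have "a \<noteq> 0"
  proof
    assume "a = 0"
    then have "?K = UNIV" using * by fastforce
    then show False using dim by simp
  qed
  then show ?thesis using that * by blast
qed

text \<open>\<open>a\<close> is an eigenvector, and finite order forces the eigenvalue 1 or -1. With
  1 the map would be a transvection, whose powers drift along \<open>a\<close> and return only if it
  is the identity.\<close>

lemma finite_order_reflection:
  fixes f :: "'v::real_vector \<Rightarrow> 'v"
  assumes lin: "linear f" and a: "a \<noteq> 0" "\<And>x. \<exists>k. f x = x + k *\<^sub>R a"
    and ord: "(f ^^ n) = id" "n > 0" and ne: "f \<noteq> id"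
  shows "f a = - a" and "f (f x) = x"
proof -
  obtain k where "f a = a + k *\<^sub>R a" using a(2) by blast
  then obtain l where l: "f a = l *\<^sub>R a" by (metis scaleR_add_left scaleR_one)
  have "(f ^^ j) a = (l ^ j) *\<^sub>R a" for j
    by (induction j) (simp_all add: linear_scale[OF lin] l)
  then have "(l ^ n) *\<^sub>R a = 1 *\<^sub>R a" using ord(1) by (metis id_apply scaleR_one)
  then have "l ^ n = 1 \<or> a = 0" by (simp only: scaleR_cancel_right)
  then have "l ^ n = 1" using a(1) by blast
  then have "\<bar>l\<bar> ^ n = 1" by (simp flip: power_abs)
  then have "\<bar>l\<bar> = 1"
    using ord(2) power_eq_imp_eq_base[of "\<bar>l\<bar>" n 1] by simp
  moreover have "l \<noteq> 1"
  proof
    assume l1: "l = 1"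
    have "f x = x" for x
    proof -
      obtain k where k: "f x = x + k *\<^sub>R a" using a(2) by blast
      have "(f ^^ j) x = x + (real j * k) *\<^sub>R a" for j
        by (induction j) (simp_all add: linear_add[OF lin] linear_scale[OF lin] k l l1 algebra_simps)
      then have "(real n * k) *\<^sub>R a = 0" using ord(1) by (metis add_cancel_right_right id_apply)
      then show ?thesis using k a(1) ord(2) by simp
    qed
    then show False using ne by (simp add: fun_eq_iff)
  qed
  ultimately have "l = - 1" by linarith
  then show fa: "f a = - a" using l by simp
  obtain k where "f x = x + k *\<^sub>R a" using a(2) by blast
  then show "f (f x) = x" by (simp add: linear_add[OF lin] linear_scale[OF lin] fa)
qed

section \<open>The given faithful representation\<close>

locale reflection_representation = group W for W (structure) +
  fixes T and \<rho> :: "'a \<Rightarrow> 'v::real_vector \<Rightarrow> 'v" and B :: "'v set"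
  assumes finite_carrier: "finite (carrier W)" and T_carrier: "T \<subseteq> carrier W"
    and finite_B: "finite B" and span_B: "span B = UNIV"
    and \<rho>: "faithful_representation W \<rho>"
    and T_iff: "\<And>w. w \<in> carrier W \<Longrightarrow>
      dim (UNIV :: 'v set) - dim {v. \<rho> w v - v = 0} = 1 \<longleftrightarrow> w \<in> T"
begin

lemma T_closed [simp, intro]: "t \<in> T \<Longrightarrow> t \<in> carrier W"
  using T_carrier by auto

lemma \<rho>_hom: "\<rho> \<in> hom W general_linear_group"
  using \<rho> by (simp add: faithful_representation_def)

lemma \<rho>_mult: "v \<in> carrier W \<Longrightarrow> w \<in> carrier W \<Longrightarrow> \<rho> (v \<otimes> w) x = \<rho> v (\<rho> w x)"
  using \<rho>_hom by (auto simp: hom_def general_linear_group_def)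

lemma \<rho>_one [simp]: "\<rho> \<one> = id"
  using hom_one[OF \<rho>_hom is_group group_general_linear_group]
  by (simp add: general_linear_group_def)

lemma linear_\<rho>: "w \<in> carrier W \<Longrightarrow> linear (\<rho> w)"
  using \<rho>_hom by (auto simp: hom_def general_linear_group_def)

lemma \<rho>_inject: "v \<in> carrier W \<Longrightarrow> w \<in> carrier W \<Longrightarrow> (\<And>x. \<rho> v x = \<rho> w x) \<Longrightarrow> v = w"
  using \<rho> inj_onD[of \<rho> "carrier W" v w] by (simp add: faithful_representation_def ext)

lemma \<rho>_pow: "w \<in> carrier W \<Longrightarrow> \<rho> (w [^] (n::nat)) = \<rho> w ^^ n"
  by (induction n) (simp_all add: fun_eq_iff \<rho>_mult funpow_swap1)

lemma one_notin_T: "\<one> \<notin> T"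
  using T_iff[of \<one>] by simp

text \<open>\<open>\<rho> g\<close> carries the fixed space of \<open>t\<close> onto that of the
  conjugate and preserves dimensions, so the codimension criterion transfers.\<close>

lemma T_conjugate:
  assumes "g \<in> carrier W" "t \<in> T"
  shows "g \<otimes> t \<otimes> inv g \<in> T"
proof -
  let ?u = "g \<otimes> t \<otimes> inv g"
  note lt = linear_\<rho>[OF T_closed[OF assms(2)]]
  have inv: "\<rho> (inv g) (\<rho> g x) = x" "\<rho> g (\<rho> (inv g) x) = x" for x
    using assms(1) by (simp_all flip: \<rho>_mult)
  have "{v. \<rho> ?u v - v = 0} = \<rho> g ` {v. \<rho> t v - v = 0}"
  proof (intro equalityI subsetI)
    fix x assume "x \<in> {v. \<rho> ?u v - v = 0}"
    then have "\<rho> g (\<rho> t (\<rho> (inv g) x)) = x" using assms by (simp add: \<rho>_mult)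
    then have "\<rho> t (\<rho> (inv g) x) = \<rho> (inv g) x" using inv(1) by metis
    then show "x \<in> \<rho> g ` {v. \<rho> t v - v = 0}"
      using inv(2) by (intro image_eqI[of _ _ "\<rho> (inv g) x"]) auto
  qed (use assms inv in \<open>auto simp: \<rho>_mult\<close>)
  moreover have "dim (\<rho> g ` K) = dim K" if "subspace K" for K
  proof -
    have inj: "inj (\<rho> g)" using inv(1) by (metis injI)
    obtain C where C: "C \<subseteq> K" "independent C" "K \<subseteq> span C" using maximal_independent_subset by blast
    have "span C = K" using C that by (simp add: span_minimal subset_antisym)
    moreover have "span K = K" using that by (simp add: span_eq_iff)
    ultimately have "dim K = card C"
      using dim_eq_card[of C K] \<open>span C = K\<close> C(2) by argo
    moreover have "dim (\<rho> g ` K) = card (\<rho> g ` C)"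
    proof (rule dim_eq_card)
      show "span (\<rho> g ` C) = span (\<rho> g ` K)"
        using \<open>span C = K\<close> linear_span_image[OF linear_\<rho>[OF assms(1)]] by (metis span_span)
      show "independent (\<rho> g ` C)"
        using linear_independent_injective_image[OF linear_\<rho>[OF assms(1)] C(2)] inj
        by (meson inj_on_subset subset_UNIV)
    qed
    moreover have "card (\<rho> g ` C) = card C" using inj by (simp add: card_image inj_on_subset)
    ultimately show ?thesis by simp
  qed
  moreover have "subspace {v. \<rho> t v - v = 0}"
    by (auto simp: subspace_def linear_add[OF lt] linear_scale[OF lt] linear_0[OF lt])
  ultimately show ?thesis using T_iff[of t] T_iff[of ?u] assms by auto
qed

text \<open>The vector \<open>a\<close> serves as the root of \<open>t\<close> in the given
  representation, where no invariant form has been fixed.\<close>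

lemma T_vector:
  assumes "t \<in> T"
  obtains a where "a \<noteq> 0" "\<rho> t a = - a" "\<And>x. \<exists>k. \<rho> t x = x + k *\<^sub>R a"
    "\<And>x. \<rho> t (\<rho> t x) = x"
proof -
  have t: "t \<in> carrier W" using assms by auto
  obtain a where a: "a \<noteq> 0" "\<And>x. \<exists>k. \<rho> t x = x + k *\<^sub>R a"
    by (rule codim_one_vector[OF finite_B span_B linear_\<rho>[OF t] iffD2[OF T_iff[OF t] assms]]) (rule that)
  have "\<rho> t ^^ ord t = id" using t by (simp flip: \<rho>_pow)
  moreover have "ord t > 0" using ord_ge_1[OF finite_carrier t] by simp
  moreover have "\<rho> t \<noteq> id"
    using \<rho>_inject[of t \<one>] t one_notin_T assms by auto
  ultimately have "\<rho> t a = - a" "\<And>x. \<rho> t (\<rho> t x) = x"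
    using finite_order_reflection[OF linear_\<rho>[OF t] a] by blast+
  then show ?thesis using that a by blast
qed

lemma T_square: "t \<in> T \<Longrightarrow> t \<otimes> t = \<one>"
proof (rule \<rho>_inject)
  assume t: "t \<in> T"
  show "\<rho> (t \<otimes> t) x = \<rho> \<one> x" for x
    using T_vector[OF t] t by (metis T_closed \<rho>_mult \<rho>_one id_apply)
qed auto

text \<open>Commutation makes \<open>\<rho> t\<close> preserve the line of \<open>b\<close>, on
  which \<open>\<rho> r\<close> is -1; so \<open>b\<close> is an eigenvector of
  \<open>\<rho> t\<close> with eigenvalue 1 or -1. With -1 the two reflections would
  coincide.\<close>

lemma commuting_reflections:
  assumes t: "t \<in> T" and r: "r \<in> T" and comm: "t \<otimes> r = r \<otimes> t" and "t \<noteq> r"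
    and b: "b \<noteq> 0" "\<rho> r b = - b" "\<And>x. \<exists>k. \<rho> r x = x + k *\<^sub>R b"
  shows "\<rho> t b = b"
proof -
  obtain a where a: "a \<noteq> 0" "\<rho> t a = - a" "\<And>x. \<exists>k. \<rho> t x = x + k *\<^sub>R a"
    "\<And>x. \<rho> t (\<rho> t x) = x"
    using T_vector[OF t] by blast
  note lt = linear_\<rho>[OF T_closed[OF t]] and lr = linear_\<rho>[OF T_closed[OF r]]
  have c: "\<rho> t (\<rho> r x) = \<rho> r (\<rho> t x)" for x
    using arg_cong[OF comm, of "\<lambda>w. \<rho> w x"] t r by (simp add: \<rho>_mult)
  have neg: "\<rho> r (\<rho> t b) = - \<rho> t b" using c[of b] b(2) linear_neg[OF lt] by simp
  obtain k where k: "\<rho> r (\<rho> t b) = \<rho> t b + k *\<^sub>R b" using b(3) by blast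
  have "k *\<^sub>R b = \<rho> r (\<rho> t b) - \<rho> t b" unfolding k by simp
  also have "\<dots> = (- 2) *\<^sub>R \<rho> t b" unfolding neg by (simp add: scaleR_2)
  finally have "k *\<^sub>R b = (- 2) *\<^sub>R \<rho> t b" .
  moreover have "\<rho> t b = (- 1 / 2) *\<^sub>R ((- 2) *\<^sub>R \<rho> t b)" by simp
  ultimately have "\<rho> t b = (- 1 / 2) *\<^sub>R (k *\<^sub>R b)" by (simp only:)
  then obtain m where m: "\<rho> t b = m *\<^sub>R b" unfolding scaleR_scaleR by blast
  have "\<rho> t (\<rho> t b) = (m * m) *\<^sub>R b" using m linear_scale[OF lt] by simp
  then have "(m * m) *\<^sub>R b = 1 *\<^sub>R b" using a(4)[of b] by simp
  then have "m * m = 1 \<or> b = 0" by (simp only: scaleR_cancel_right)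
  then have "m * m = 1" using b(1) by blast
  moreover have "m \<noteq> - 1"
  proof
    assume "m = - 1"
    then have tb: "\<rho> t b = - b" using m by simp
    obtain l where l: "\<rho> t b = b + l *\<^sub>R a" using a(3) by blast
    have "l *\<^sub>R a = \<rho> t b - b" unfolding l by simp
    also have "\<dots> = (- 2) *\<^sub>R b" unfolding tb by (simp add: scaleR_2)
    finally have la: "l *\<^sub>R a = (- 2) *\<^sub>R b" .
    then have lne: "l \<noteq> 0" using b(1) by auto
    have "(1 / l) *\<^sub>R (l *\<^sub>R a) = (1 / l) *\<^sub>R ((- 2) *\<^sub>R b)" by (simp only: la)
    then have ab: "a = (- 2 / l) *\<^sub>R b" using lne by simp
    have "\<rho> t x = \<rho> r x" for x
    proof -
      obtain k' where k': "\<rho> t x = x + k' *\<^sub>R a" using a(3) by blast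
      define k where "k = - k' / l"
      have k: "\<rho> t x = x + (2 * k) *\<^sub>R b" by (simp add: k' ab k_def)
      \<comment> \<open>The midpoint of \<open>x\<close> and its image under
        \<open>\<rho> t\<close>, hence fixed by \<open>\<rho> t\<close>. Commutation forces
        \<open>\<rho> r\<close> to fix it too, and then both maps send
        \<open>x = y - k *\<^sub>R b\<close> to \<open>y + k *\<^sub>R b\<close>.\<close>
      define y where "y = x + k *\<^sub>R b"
      have tk: "\<rho> t y = x + (2 * k) *\<^sub>R b + k *\<^sub>R (- b)"
        by (simp add: y_def linear_add[OF lt] linear_scale[OF lt] k tb)
      have "(2 * k) *\<^sub>R b + k *\<^sub>R (- b) = k *\<^sub>R b"
        using scaleR_left_diff_distrib[of "2 * k" k b] by simp
      then have "x + (2 * k) *\<^sub>R b + k *\<^sub>R (- b) = y" by (simp only: y_def add.assoc)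
      with tk have ty: "\<rho> t y = y" by (simp only:)
      obtain n where n: "\<rho> r y = y + n *\<^sub>R b" using b(3) by blast
      have "y + n *\<^sub>R (- b) = \<rho> t (\<rho> r y)"
        by (simp add: n linear_add[OF lt] linear_scale[OF lt] ty tb)
      also have "\<dots> = y + n *\<^sub>R b" using c[of y] ty n by simp
      finally have "n *\<^sub>R (- b) = n *\<^sub>R b" by (simp only: add_left_cancel)
      moreover have "(2 * n) *\<^sub>R b = n *\<^sub>R b - n *\<^sub>R (- b)"
        using scaleR_left_distrib[of n n b] by simp
      ultimately have "(2 * n) *\<^sub>R b = 0" by simp
      then have ry: "\<rho> r y = y" using n b(1) by simp
      have x: "x = y - k *\<^sub>R b" by (simp add: y_def)
      have "\<rho> r x = y - k *\<^sub>R (- b)"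
        by (subst x) (simp add: linear_diff[OF lr] linear_scale[OF lr] ry b(2))
      also have "\<dots> = \<rho> t x"
        using scaleR_left_distrib[of k k b] unfolding k y_def by simp
      finally show ?thesis by simp
    qed
    then show False using \<rho>_inject[of t r] t r \<open>t \<noteq> r\<close> by blast
  qed
  ultimately have "m = 1" using square_eq_1_iff[of m] by auto
  then show ?thesis using m by simp
qed

text \<open>Suppose \<open>t\<close> reflects in no root. As an involution it is a product of
  reflections \<open>r\<close> in roots that it negates; each \<open>r\<close> commutes with
  \<open>t\<close> and differs from it, so it fixes the vector \<open>a\<close> of \<open>t\<close>.
  Then \<open>t\<close> fixes \<open>a\<close>, although it negates it.\<close>

lemma reflects_if_in_T:
  assumes "finite_coxeter_group W S" "S \<subseteq> T" "t \<in> T"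
  shows "\<exists>x. finite_coxeter_group.reflects W S t x"
proof (rule ccontr)
  interpret C: finite_coxeter_group W S by fact
  assume no: "\<not> ?thesis"
  have t: "t \<in> carrier W" using assms(3) by auto
  obtain rs where rs: "\<And>p. p \<in> set rs \<Longrightarrow> C.reflects (fst p) (snd p) \<and> C.act t (snd p) = - snd p"
    "t = list_product W (map fst rs)"
    using C.involution_product_of_reflections[OF t T_square[OF assms(3)]] by blast
  obtain a where a: "a \<noteq> 0" "\<rho> t a = - a" "\<And>x. \<exists>k. \<rho> t x = x + k *\<^sub>R a"
    "\<And>x. \<rho> t (\<rho> t x) = x"
    by (rule T_vector[OF assms(3)]) (rule that)
  have fixed: "r \<in> carrier W \<and> \<rho> r a = a" if "(r, x) \<in> set rs" for r x
  proof -
    have rx: "C.reflects r x" "C.act t x = - x" using rs(1)[OF that] by auto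
    then obtain g s where "g \<in> carrier W" "s \<in> S" "r = g \<otimes> s \<otimes> inv g"
      using C.reflects_conjugate_simple by blast
    then have r: "r \<in> T" using T_conjugate assms(2) by auto
    have "C.reflects (t \<otimes> r \<otimes> inv t) (- x)" using C.reflects_conjugate[OF t rx(1)] rx(2) by simp
    then have "t \<otimes> r \<otimes> inv t = r" using C.reflects_unique C.reflects_uminus[OF rx(1)] by blast
    then have "r \<otimes> t = t \<otimes> r" using t r by (metis inv_solve_right' m_closed T_closed)
    moreover have "r \<noteq> t" using no rx(1) by blast
    ultimately show ?thesis using commuting_reflections[OF r assms(3) _ _ a(1-3)] r by auto
  qed
  have "\<rho> (list_product W (map fst ps)) a = a \<and> list_product W (map fst ps) \<in> carrier W"
    if "set ps \<subseteq> set rs" for ps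
    using that by (induction ps) (use fixed in \<open>auto simp: \<rho>_mult\<close>)
  then have "a = - a" using rs(2) a(2) by auto
  moreover have "2 *\<^sub>R a = a - (- a)" by (simp add: scaleR_2)
  ultimately have "2 *\<^sub>R a = 0" by simp
  then show False using a(1) by simp
qed

end

section \<open>Hurwitz moves in the presented group\<close>

lemma (in comm_group) finprod_eq_list_product:
  assumes "distinct xs" "set xs \<subseteq> carrier G"
  shows "finprod G (\<lambda>x. x) (set xs) = list_product G xs"
  using assms by (induction xs) (auto simp: Pi_iff subset_eq)

lemma finprod_subgroup_generated:
  assumes "group W" "comm_group (subgroup_generated W L)" "distinct xs" "set xs = L" "L \<subseteq> carrier W"
  shows "finprod (subgroup_generated W L) (\<lambda>x. x) L = list_product W xs"
proof -
  interpret W: group W by fact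
  interpret L: comm_group "subgroup_generated W L" by fact
  have "set xs \<subseteq> carrier (subgroup_generated W L)"
    using assms(4,5) W.subgroup_generated_subset_carrier_subset[of L] by simp
  then have "finprod (subgroup_generated W L) (\<lambda>x. x) L = list_product (subgroup_generated W L) xs"
    using L.finprod_eq_list_product[OF assms(3)] assms(4) by simp
  also have "\<dots> = list_product W xs" by (simp add: list_product_def subgroup_generated_def)
  finally show ?thesis .
qed

text \<open>Enumerations of \<open>L\<close> and \<open>R\<close> are concatenated, and disjointness
  keeps the list distinct. From here on \<open>c\<close> is a product of all simple reflections,
  each taken once.\<close>

lemma coxeter_element_list:
  assumes "group W" "coxeter_element W T c" "finite (carrier W)"
  obtains S xs where "S \<subseteq> T" "coxeter_system W S" "distinct xs" "set xs = S" "c = list_product W xs"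
proof -
  interpret group W by fact
  obtain L R where LR: "chromatic_pair W T L R"
    and c: "c = finprod (subgroup_generated W L) (\<lambda>s. s) L \<otimes>\<^bsub>W\<^esub>
      finprod (subgroup_generated W R) (\<lambda>s. s) R"
    using assms(2) by (auto simp: coxeter_element_def)
  have sub: "L \<subseteq> carrier W" "R \<subseteq> carrier W"
    using LR by (auto simp: chromatic_pair_def coxeter_system_def)
  obtain ls where ls: "distinct ls" "set ls = L"
    using finite_distinct_list finite_subset[OF sub(1) assms(3)] by blast
  obtain rs where rs: "distinct rs" "set rs = R"
    using finite_distinct_list finite_subset[OF sub(2) assms(3)] by blast
  have "c = list_product W (ls @ rs)"
    using LR sub ls rs finprod_subgroup_generated[OF assms(1)]
    by (simp add: c chromatic_pair_def)
  then show ?thesis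
    using that[of "L \<union> R" "ls @ rs"] LR ls rs by (auto simp: chromatic_pair_def)
qed

text \<open>The given representation survives only through the assumptions on \<open>T\<close>, and
  its type no longer occurs. \<open>reflects_T\<close> places \<open>T\<close> among the reflections
  of the geometric representation.\<close>

locale dual_presentation = group W for W (structure) +
  fixes T S :: "'a set" and xs :: "'a list"
  assumes finite_carrier: "finite (carrier W)" and T_carrier: "T \<subseteq> carrier W"
    and T_square: "\<And>t. t \<in> T \<Longrightarrow> t \<otimes> t = \<one>"
    and T_conjugate: "\<And>g t. g \<in> carrier W \<Longrightarrow> t \<in> T \<Longrightarrow> g \<otimes> t \<otimes> inv g \<in> T"
    and S_T: "S \<subseteq> T" and coxeter: "coxeter_system W S"
    and reflects_T: "\<And>t. t \<in> T \<Longrightarrow> \<exists>x. finite_coxeter_group.reflects W S t x"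
    and distinct_xs: "distinct xs" and set_xs: "set xs = S"

sublocale dual_presentation \<subseteq> C: finite_coxeter_group W S
  by unfold_locales (fact finite_carrier coxeter)+

context dual_presentation
begin

abbreviation c where "c \<equiv> list_product W xs"

lemma T_closed [simp, intro]: "t \<in> T \<Longrightarrow> t \<in> carrier W"
  using T_carrier by auto

lemma T_inv: "t \<in> T \<Longrightarrow> inv t = t"
  using T_square by (intro inv_equality) auto

lemma T_conjugate_inv: "g \<in> carrier W \<Longrightarrow> t \<in> T \<Longrightarrow> inv g \<otimes> t \<otimes> g \<in> T"
  using T_conjugate[of "inv g" t] by simp

lemma list_product_T_closed [simp]: "set zs \<subseteq> T \<Longrightarrow> list_product W zs \<in> carrier W"
  using T_carrier by (intro list_product_closed) auto

lemma xs_T: "set xs \<subseteq> T"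
  using set_xs S_T by simp

lemma c_closed [simp]: "c \<in> carrier W"
  using xs_T by simp

section \<open>Reflection length and the order below the Coxeter element\<close>

lemma refl_length_le: "set zs \<subseteq> T \<Longrightarrow> refl_length W T (list_product W zs) \<le> length zs"
  unfolding refl_length_def by (rule Least_le) (auto simp: in_lists_conv_set)

lemma T_word:
  assumes "w \<in> carrier W"
  shows "\<exists>zs. set zs \<subseteq> T \<and> length zs = refl_length W T w \<and> list_product W zs = w"
proof -
  obtain ys where "set ys \<subseteq> S" "w = list_product W ys" using C.S_words[OF assms] by blast
  then have "\<exists>n. \<exists>zs\<in>lists T. length zs = n \<and> list_product W zs = w"
    using S_T by (auto simp: in_lists_conv_set)
  from LeastI_ex[OF this] show ?thesis by (auto simp: refl_length_def in_lists_conv_set)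
qed

lemma refl_length_mult:
  assumes "v \<in> carrier W" "w \<in> carrier W"
  shows "refl_length W T (v \<otimes> w) \<le> refl_length W T v + refl_length W T w"
proof -
  obtain ys where ys: "set ys \<subseteq> T" "length ys = refl_length W T v" "list_product W ys = v"
    using T_word[OF assms(1)] by blast
  obtain zs where zs: "set zs \<subseteq> T" "length zs = refl_length W T w" "list_product W zs = w"
    using T_word[OF assms(2)] by blast
  have "set ys \<subseteq> carrier W" "set zs \<subseteq> carrier W" using ys zs T_carrier by auto
  then show ?thesis using refl_length_le[of "ys @ zs"] ys zs by simp
qed

lemma refl_length_c: "refl_length W T c = length xs"
proof (rule antisym)
  show "refl_length W T c \<le> length xs" using refl_length_le[OF xs_T] .
  obtain zs where zs: "set zs \<subseteq> T" "length zs = refl_length W T c" "list_product W zs = c"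
    using T_word[of c] by auto
  then have "card S \<le> length zs"
    using C.card_le_reflection_factors[OF set_xs distinct_xs, of zs] reflects_T by auto
  then show "length xs \<le> refl_length W T c"
    using zs(2) set_xs distinct_card[OF distinct_xs] by simp
qed

text \<open>Conjugating the letters to their left brings \<open>s\<close> and \<open>t\<close> to
  the front. What follows is a word of length n - 2 for the cofactor, n being the reflection length
  of \<open>c\<close>, and subadditivity turns the bounds into an equality.\<close>

lemma refl_prec_subword:
  assumes "set (as @ s # ms @ t # bs) \<subseteq> T" "list_product W (as @ s # ms @ t # bs) = c"
    and len: "length (as @ s # ms @ t # bs) = length xs"
  shows "refl_prec W T (s \<otimes> t) c"
proof -
  let ?g = "s \<otimes> t"
  have sub: "set as \<subseteq> T" "set ms \<subseteq> T" "set bs \<subseteq> T" "s \<in> T" "t \<in> T" using assms(1) by auto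
  note carr = sub(1-3)[THEN subset_trans[OF _ T_carrier]] T_closed[OF sub(4)] T_closed[OF sub(5)]
  define A M B where "A = list_product W as" and "M = list_product W ms" and "B = list_product W bs"
  have ABM: "A \<in> carrier W" "M \<in> carrier W" "B \<in> carrier W" using sub by (auto simp: A_def M_def B_def)
  have c: "c = A \<otimes> (s \<otimes> (M \<otimes> (t \<otimes> B)))"
    using assms(2) carr by (simp add: A_def M_def B_def)
  \<comment> \<open>Letters of \<open>as\<close> are moved past both \<open>s\<close> and
    \<open>t\<close>, letters of \<open>ms\<close> only past \<open>t\<close>.\<close>
  define zs where "zs = map (\<lambda>x. inv ?g \<otimes> x \<otimes> ?g) as @ map (\<lambda>x. inv t \<otimes> x \<otimes> t) ms @ bs"
  have zsT: "set zs \<subseteq> T" using sub by (auto simp: zs_def intro!: T_conjugate_inv)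
  have "list_product W zs = (inv ?g \<otimes> A \<otimes> ?g) \<otimes> ((inv t \<otimes> M \<otimes> t) \<otimes> B)"
  proof -
    have "set (map (\<lambda>x. inv ?g \<otimes> x \<otimes> ?g) as) \<subseteq> carrier W"
      "set (map (\<lambda>x. inv t \<otimes> x \<otimes> t) ms) \<subseteq> carrier W"
      using carr by auto
    then show ?thesis
      using carr by (simp add: zs_def list_product_conjugate A_def M_def B_def)
  qed
  also have "\<dots> = inv ?g \<otimes> (A \<otimes> (s \<otimes> (t \<otimes> inv t) \<otimes> (M \<otimes> (t \<otimes> B))))"
    using ABM carr by (simp only: m_assoc m_closed inv_closed)
  also have "\<dots> = inv ?g \<otimes> c"
    using ABM carr by (simp add: c)
  finally have zs: "list_product W zs = inv ?g \<otimes> c" .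
  have g: "?g \<in> carrier W" using carr by simp
  have "refl_length W T ?g \<le> 2" using refl_length_le[of "[s, t]"] sub carr by simp
  moreover have "refl_length W T (inv ?g \<otimes> c) + 2 \<le> refl_length W T c"
    using refl_length_le[OF zsT] len unfolding zs refl_length_c by (simp add: zs_def)
  moreover have "refl_length W T c \<le> refl_length W T ?g + refl_length W T (inv ?g \<otimes> c)"
    using refl_length_mult[of ?g "inv ?g \<otimes> c"] g by (simp add: m_assoc[symmetric])
  ultimately show ?thesis by (simp add: refl_prec_def)
qed

section \<open>Relations in the presented group\<close>

abbreviation Rel where "Rel \<equiv> dual_braid_relations W T c \<union> square_relations T"
abbreviation P where "P \<equiv> presented_group T Rel"

definition gen where "gen t = pres_class T Rel [(t, True)]"

lemma group_P: "group P"
  by (rule group_presented_group)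

sublocale P: group P
  by (rule group_P)

lemma gen_closed [simp]: "t \<in> T \<Longrightarrow> gen t \<in> carrier P"
  by (auto simp: gen_def carrier_presented_group)

lemma gen_mult: "s \<in> T \<Longrightarrow> t \<in> T \<Longrightarrow> gen s \<otimes>\<^bsub>P\<^esub> gen t = pres_class T Rel (positive [s, t])"
  by (simp add: gen_def presented_group_mult positive_def)

lemma gen_square: "t \<in> T \<Longrightarrow> gen t \<otimes>\<^bsub>P\<^esub> gen t = \<one>\<^bsub>P\<^esub>"
proof -
  assume t: "t \<in> T"
  then have "pres_equiv T Rel (positive [t, t]) []"
    by (intro pres_equiv.relation) (auto simp: positive_def square_relations_def)
  then show ?thesis
    using t by (simp add: gen_mult one_presented_group pres_class_eq_iff positive_def)
qed

lemma gen_braid: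
  assumes "s \<in> T" "t \<in> T" "refl_prec W T (s \<otimes> t) c"
  shows "gen s \<otimes>\<^bsub>P\<^esub> gen t = gen (s \<otimes> t \<otimes> inv s) \<otimes>\<^bsub>P\<^esub> gen s"
proof -
  have u: "s \<otimes> t \<otimes> inv s \<in> T" using assms T_conjugate by auto
  have "(positive [s, t], positive [s \<otimes> t \<otimes> inv s, s]) \<in> Rel"
    using assms by (auto simp: dual_braid_relations_def)
  then have "pres_equiv T Rel (positive [s, t]) (positive [s \<otimes> t \<otimes> inv s, s])"
    using assms u by (intro pres_equiv.relation) (auto simp: positive_def)
  then show ?thesis
    using assms u by (simp add: gen_mult pres_class_eq_iff positive_def)
qed

text \<open>In the dihedral subgroup, the reflections \<open>t\<^sub>i = s (s t)\<^sup>i\<close> satisfy \<open>t\<^sub>i t\<^sub>i\<^sub>+\<^sub>1 = s t\<close>, so the dual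
  braid relations make all the products of consecutive generators equal.\<close>

lemma gen_dihedral:
  assumes s: "s \<in> T" and t: "t \<in> T" and prec: "refl_prec W T (s \<otimes> t) c"
  shows "(gen s \<otimes>\<^bsub>P\<^esub> gen t) [^]\<^bsub>P\<^esub> ord (s \<otimes> t) = \<one>\<^bsub>P\<^esub>"
proof -
  define g \<gamma> where "g = s \<otimes> t" and "\<gamma> = gen s \<otimes>\<^bsub>P\<^esub> gen t"
  have g: "g \<in> carrier W" and \<gamma>: "\<gamma> \<in> carrier P" using s t by (auto simp: g_def \<gamma>_def)
  define u where "u i = s \<otimes> g [^] (i::nat)" for i
  have u0: "u 0 = s" using s by (simp add: u_def)
  have uS: "u (Suc i) = u i \<otimes> g" for i using s g by (simp add: u_def m_assoc)
  have u1: "u (Suc 0) = t" using s t by (simp add: uS u0 g_def T_square flip: m_assoc)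
  have uT: "u i \<in> T \<and> u (Suc i) \<in> T \<and> u i \<otimes> u (Suc i) = g" for i
  proof (induction i)
    case 0
    then show ?case using s t u1 by (simp add: u0 g_def)
  next
    case (Suc i)
    then have T: "u i \<in> T" "u (Suc i) \<in> T" by auto
    have "u (Suc (Suc i)) = u (Suc i) \<otimes> u i \<otimes> inv (u (Suc i))"
      using T Suc by (simp add: uS[of "Suc i"] T_inv m_assoc)
    then have "u (Suc (Suc i)) \<in> T" using T T_conjugate by simp
    moreover have "u (Suc i) \<otimes> u (Suc (Suc i)) = g"
      using T g by (simp add: uS[of "Suc i"] T_square flip: m_assoc)
    ultimately show ?case using T by simp
  qed
  have step: "gen (u i) \<otimes>\<^bsub>P\<^esub> gen (u (Suc i)) = \<gamma>" for i
  proof (induction i)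
    case 0
    show ?case by (simp add: u0 u1 \<gamma>_def)
  next
    case (Suc i)
    have T: "u i \<in> T" "u (Suc i) \<in> T" "u (Suc (Suc i)) \<in> T" using uT by blast+
    have "u (Suc i) \<otimes> u (Suc (Suc i)) \<otimes> inv (u (Suc i)) = u i \<otimes> u (Suc i) \<otimes> inv (u (Suc i))"
      using uT by simp
    also have "\<dots> = u i" using T by (simp add: m_assoc)
    finally show ?case
      using gen_braid[OF T(2,3)] uT[of "Suc i"] prec Suc by (simp add: g_def)
  qed
  have gen_u: "gen (u i) = gen s \<otimes>\<^bsub>P\<^esub> \<gamma> [^]\<^bsub>P\<^esub> i" for i
  proof (induction i)
    case 0
    then show ?case using s by (simp add: u0)
  next
    case (Suc i)
    have T: "u i \<in> T" "u (Suc i) \<in> T" using uT by blast+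
    have "gen (u (Suc i)) = gen (u i) \<otimes>\<^bsub>P\<^esub> (gen (u i) \<otimes>\<^bsub>P\<^esub> gen (u (Suc i)))"
      using T by (simp add: gen_square flip: P.m_assoc)
    also have "\<dots> = gen (u i) \<otimes>\<^bsub>P\<^esub> \<gamma>" by (simp only: step)
    also have "\<dots> = gen s \<otimes>\<^bsub>P\<^esub> \<gamma> [^]\<^bsub>P\<^esub> i \<otimes>\<^bsub>P\<^esub> \<gamma>" by (simp only: Suc)
    finally show ?case using s \<gamma> by (simp add: P.m_assoc)
  qed
  \<comment> \<open>\<open>u\<close> returns to \<open>s\<close> at index \<open>ord g\<close>, so
    \<open>gen_u\<close> there must give \<open>gen s\<close> again, and the power of
    \<open>\<gamma>\<close> cancels.\<close>
  have "u (ord g) = s" using s g by (simp add: u_def)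
  then have "gen s \<otimes>\<^bsub>P\<^esub> \<gamma> [^]\<^bsub>P\<^esub> ord g = gen s" using gen_u[of "ord g"] by simp
  then show ?thesis using s \<gamma> by (simp add: g_def \<gamma>_def)
qed

end

context dual_presentation
begin

text \<open>Two distinct simple reflections occur in \<open>xs\<close> in one of the two orders. In
  that order their product precedes \<open>c\<close> and \<open>gen_dihedral\<close> applies; the
  other order follows by taking inverses.\<close>

lemma gen_coxeter_relation:
  assumes s: "s \<in> S" and t: "t \<in> S"
  shows "(gen s \<otimes>\<^bsub>P\<^esub> gen t) [^]\<^bsub>P\<^esub> C.coxeter_order s t = \<one>\<^bsub>P\<^esub>"
proof -
  have ordered: "(gen s \<otimes>\<^bsub>P\<^esub> gen t) [^]\<^bsub>P\<^esub> C.coxeter_order s t = \<one>\<^bsub>P\<^esub>"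
    if "xs = as @ s # ms @ t # bs" for s t as ms bs
    using gen_dihedral[of s t] refl_prec_subword[of as s ms t bs] that xs_T
    by (simp add: C.coxeter_order_def)
  have sT: "s \<in> T" and tT: "t \<in> T" using s t S_T by auto
  obtain as bs where ab: "xs = as @ s # bs" using s set_xs split_list by force
  consider "s = t" | "t \<in> set bs" | "t \<in> set as" using t set_xs ab by auto
  then show ?thesis
  proof cases
    case 1
    then show ?thesis using s sT by (simp add: C.coxeter_order_self gen_square)
  next
    case 2
    then show ?thesis using ordered ab split_list by metis
  next
    case 3
    then obtain us vs where "as = us @ t # vs" using split_list by force
    then have "(gen t \<otimes>\<^bsub>P\<^esub> gen s) [^]\<^bsub>P\<^esub> C.coxeter_order t s = \<one>\<^bsub>P\<^esub>"
      using ordered ab by simp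
    moreover have "gen s \<otimes>\<^bsub>P\<^esub> gen t = inv\<^bsub>P\<^esub> (gen t \<otimes>\<^bsub>P\<^esub> gen s)"
      using sT tT P.inv_equality[OF gen_square] by (simp add: P.inv_mult_group)
    ultimately show ?thesis
      using sT tT s t C.coxeter_order_commute[of s t] by (simp add: P.nat_pow_inv)
  qed
qed

text \<open>The section of the canonical map from \<open>P\<close> to \<open>W\<close>; the
  remaining task is to place every \<open>gen t\<close> with \<open>t \<in> T\<close> in its
  image.\<close>

definition lift where
  "lift = (SOME h. h \<in> hom W P \<and> (\<forall>s\<in>S. h s = gen s))"

lemma lift: "lift \<in> hom W P" "s \<in> S \<Longrightarrow> lift s = gen s"
proof -
  let ?Q = "\<lambda>h. h \<in> hom W P \<and> (\<forall>s\<in>S. h s = gen s)"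
  have "\<exists>h\<in>hom W P. \<forall>s\<in>S. h s = gen s"
    using S_T by (intro C.coxeter_hom_extend[OF group_P] gen_coxeter_relation) auto
  then have "\<exists>h. ?Q h" by blast
  then have "?Q lift" unfolding lift_def by (rule someI_ex[of ?Q])
  then show "lift \<in> hom W P" "s \<in> S \<Longrightarrow> lift s = gen s" by blast+
qed

lemma subgroup_lift: "subgroup (lift ` carrier W) P"
proof -
  interpret h: group_hom W P lift
    using lift(1) by (simp add: group_hom_def group_hom_axioms_def group_P is_group)
  show ?thesis by (rule h.img_is_subgroup)
qed

lemmas lift_image_closed =
  subgroup.m_closed[OF subgroup_lift] subgroup.m_inv_closed[OF subgroup_lift]
  subgroup.one_closed[OF subgroup_lift]

section \<open>Reduced words of the Coxeter element and their values in the presented group\<close>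

definition ev where "ev zs = list_product P (map gen zs)"

lemma ev_closed [simp]: "set zs \<subseteq> T \<Longrightarrow> ev zs \<in> carrier P"
  unfolding ev_def by (rule P.list_product_closed) auto

lemma ev_simps [simp]: "ev [] = \<one>\<^bsub>P\<^esub>" "ev (z # zs) = gen z \<otimes>\<^bsub>P\<^esub> ev zs"
  by (simp_all add: ev_def)

lemma ev_append [simp]: "set ys \<subseteq> T \<Longrightarrow> set zs \<subseteq> T \<Longrightarrow> ev (ys @ zs) = ev ys \<otimes>\<^bsub>P\<^esub> ev zs"
  by (induction ys) (auto simp: P.m_assoc)

lemma gen_in_lift: "s \<in> S \<Longrightarrow> gen s \<in> lift ` carrier W"
  using lift(2)[of s] by (metis C.S_closed imageI)

lemma ev_in_lift: "set zs \<subseteq> S \<Longrightarrow> ev zs \<in> lift ` carrier W"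
  by (induction zs) (auto simp: lift_image_closed gen_in_lift)

text \<open>The length is minimal by \<open>refl_length_c\<close>. The last clause adds that the
  word has the same value as \<open>xs\<close> in \<open>P\<close> and not only in \<open>W\<close>;
  Hurwitz moves preserve both.\<close>

definition reduced where
  "reduced zs \<longleftrightarrow> set zs \<subseteq> T \<and> length zs = length xs \<and> list_product W zs = c \<and> ev zs = ev xs"

lemma reduced_xs: "reduced xs"
  using xs_T by (simp add: reduced_def)

text \<open>Adjacent letters of a reduced word have a product below \<open>c\<close>. The braid
  relation is applied to \<open>t\<close> and \<open>?u\<close>: their product is
  \<open>s \<otimes> t\<close>, and conjugating \<open>?u\<close> by \<open>t\<close> gives back
  \<open>s\<close>.\<close>

lemma hurwitz_move:
  assumes "reduced (as @ s # t # bs)"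
  shows "reduced (as @ t # (inv t \<otimes> s \<otimes> t) # bs)"
proof -
  have r: "set (as @ s # t # bs) \<subseteq> T" "length (as @ s # t # bs) = length xs"
    "list_product W (as @ s # t # bs) = c" "ev (as @ s # t # bs) = ev xs"
    using assms by (simp_all add: reduced_def)
  let ?u = "inv t \<otimes> s \<otimes> t"
  have sub: "set as \<subseteq> T" "set bs \<subseteq> T" "s \<in> T" "t \<in> T" using r(1) by auto
  note carr = sub(1-2)[THEN subset_trans[OF _ T_carrier]] T_closed[OF sub(3)] T_closed[OF sub(4)]
  have u: "?u \<in> T" using sub T_conjugate_inv by simp
  have tu: "t \<otimes> ?u = s \<otimes> t" using carr by (simp flip: m_assoc)
  have "refl_prec W T (s \<otimes> t) c" using refl_prec_subword[of as s "[]" t bs] r by simp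
  moreover have "t \<otimes> ?u \<otimes> inv t = s" using carr unfolding tu by (simp add: m_assoc)
  ultimately have gen: "gen t \<otimes>\<^bsub>P\<^esub> gen ?u = gen s \<otimes>\<^bsub>P\<^esub> gen t"
    using gen_braid[of t ?u] sub u tu by simp
  have "list_product W (as @ t # ?u # bs) = list_product W (as @ s # t # bs)"
  proof -
    have "t \<otimes> (?u \<otimes> list_product W bs) = t \<otimes> ?u \<otimes> list_product W bs"
      using carr by (intro m_assoc[symmetric]) auto
    also have "\<dots> = s \<otimes> (t \<otimes> list_product W bs)"
      unfolding tu using carr by (intro m_assoc) auto
    finally show ?thesis using carr by simp
  qed
  moreover have "ev (as @ t # ?u # bs) = ev (as @ s # t # bs)"
  proof -
    have "gen t \<otimes>\<^bsub>P\<^esub> (gen ?u \<otimes>\<^bsub>P\<^esub> ev bs) = gen t \<otimes>\<^bsub>P\<^esub> gen ?u \<otimes>\<^bsub>P\<^esub> ev bs"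
      using sub u by (intro P.m_assoc[symmetric]) auto
    also have "\<dots> = gen s \<otimes>\<^bsub>P\<^esub> (gen t \<otimes>\<^bsub>P\<^esub> ev bs)"
      unfolding gen using sub by (intro P.m_assoc) auto
    finally show ?thesis using sub u by simp
  qed
  ultimately show ?thesis using r u by (simp add: reduced_def)
qed

text \<open>Repeated moves carry \<open>x\<close> across \<open>ys\<close>; the letters of
  \<open>ys\<close> are kept and \<open>x\<close> is conjugated by each in turn.\<close>

lemma hurwitz_move_right:
  assumes "reduced (as @ x # ys @ bs)"
  shows "reduced (as @ ys @ (inv (list_product W ys) \<otimes> x \<otimes> list_product W ys) # bs)"
  using assms
proof (induction ys arbitrary: as x)
  case Nil
  then have "x \<in> carrier W" by (auto simp: reduced_def)
  then show ?case using Nil by simp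
next
  case (Cons y ys)
  then have T: "x \<in> carrier W" "y \<in> carrier W" "set ys \<subseteq> T" by (auto simp: reduced_def)
  let ?p = "list_product W ys"
  have "reduced ((as @ [y]) @ (inv y \<otimes> x \<otimes> y) # ys @ bs)"
    using hurwitz_move[of as x y "ys @ bs"] Cons.prems by simp
  then have "reduced ((as @ [y]) @ ys @ (inv ?p \<otimes> (inv y \<otimes> x \<otimes> y) \<otimes> ?p) # bs)"
    by (rule Cons.IH)
  moreover have "inv ?p \<otimes> (inv y \<otimes> x \<otimes> y) \<otimes> ?p = inv (y \<otimes> ?p) \<otimes> x \<otimes> (y \<otimes> ?p)"
    using T by (simp add: inv_mult_group m_assoc)
  ultimately show ?case by simp
qed

text \<open>The same moves carry \<open>t\<close> to the left unchanged, conjugating the letters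
  that it passes.\<close>

lemma hurwitz_move_left:
  assumes "reduced (as @ ys @ t # bs)"
  shows "\<exists>zs. reduced (as @ t # zs)"
  using assms
proof (induction ys arbitrary: bs rule: rev_induct)
  case (snoc y ys)
  then have "reduced ((as @ ys) @ t # (inv t \<otimes> y \<otimes> t) # bs)"
    by (intro hurwitz_move) simp
  then show ?case using snoc.IH[of "(inv t \<otimes> y \<otimes> t) # bs"] by simp
qed auto

text \<open>The first clause provides a word from which further moves can start, so both clauses
  propagate together along conjugation by \<open>c\<close>.\<close>

definition reached where
  "reached t \<longleftrightarrow> (\<exists>zs. reduced (t # zs)) \<and> gen t \<in> lift ` carrier W"

text \<open>The whole word has the value \<open>ev xs\<close>, which lies in the image of
  \<open>lift\<close>. If the letters before the last contribute a value in that subgroup, so does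
  the last one.\<close>

lemma reached_last:
  assumes "reduced (zs @ [y])" "ev zs \<in> lift ` carrier W"
  shows "reached y"
proof -
  have T: "set zs \<subseteq> T" "y \<in> T" and ev: "ev (zs @ [y]) = ev xs"
    using assms(1) by (auto simp: reduced_def)
  have "gen y = inv\<^bsub>P\<^esub> ev zs \<otimes>\<^bsub>P\<^esub> (ev zs \<otimes>\<^bsub>P\<^esub> gen y)"
    using T by (simp flip: P.m_assoc)
  also have "\<dots> = inv\<^bsub>P\<^esub> ev zs \<otimes>\<^bsub>P\<^esub> ev xs" using ev T by simp
  also have "\<dots> \<in> lift ` carrier W"
    using set_xs by (intro lift_image_closed(1)[OF lift_image_closed(2)[OF assms(2)]] ev_in_lift) simp
  finally show ?thesis
    using hurwitz_move_left[of "[]" zs y "[]"] assms(1) by (simp add: reached_def)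
qed

lemma reached_suffix_conjugate:
  assumes "xs = as @ s # bs"
  shows "reached (inv (list_product W bs) \<otimes> s \<otimes> list_product W bs)"
proof (rule reached_last)
  show "reduced ((as @ bs) @ [inv (list_product W bs) \<otimes> s \<otimes> list_product W bs])"
    using hurwitz_move_right[of as s bs "[]"] reduced_xs assms by simp
  show "ev (as @ bs) \<in> lift ` carrier W"
    using assms set_xs by (intro ev_in_lift) auto
qed

text \<open>Carrying \<open>x\<close> across the rest of its word conjugates it by that rest. This
  equals conjugation by \<open>c\<close>, because \<open>c\<close> is \<open>x\<close> times the
  rest.\<close>

lemma reached_conjugate:
  assumes "reached x"
  shows "reached (inv c \<otimes> x \<otimes> c)"
proof -
  obtain zs where zs: "reduced (x # zs)" and gx: "gen x \<in> lift ` carrier W"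
    using assms by (auto simp: reached_def)
  have T: "x \<in> T" "set zs \<subseteq> T" and c: "c = x \<otimes> list_product W zs" and ev: "ev (x # zs) = ev xs"
    using zs by (auto simp: reduced_def)
  have "inv c \<otimes> x \<otimes> c = inv (list_product W zs) \<otimes> x \<otimes> list_product W zs"
    using T by (simp add: c inv_mult_group m_assoc T_square)
  then have "reduced (zs @ [inv c \<otimes> x \<otimes> c])"
    using hurwitz_move_right[of "[]" x zs "[]"] zs by simp
  moreover have "ev zs \<in> lift ` carrier W"
  proof -
    have "ev zs = inv\<^bsub>P\<^esub> gen x \<otimes>\<^bsub>P\<^esub> (gen x \<otimes>\<^bsub>P\<^esub> ev zs)"
      using T by (simp flip: P.m_assoc)
    also have "\<dots> = inv\<^bsub>P\<^esub> gen x \<otimes>\<^bsub>P\<^esub> ev xs" using ev by simp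
    also have "\<dots> \<in> lift ` carrier W"
      using set_xs by (intro lift_image_closed(1)[OF lift_image_closed(2)[OF gx]] ev_in_lift) simp
    finally show ?thesis .
  qed
  ultimately show ?thesis by (rule reached_last)
qed

lemma reached_if_pow_conjugate:
  assumes "t \<in> carrier W" "reached (c [^] (k::nat) \<otimes> t \<otimes> inv (c [^] k))"
  shows "reached t"
  using assms(2)
proof (induction k)
  case 0
  then show ?case using assms(1) by simp
next
  case (Suc k)
  let ?v = "c [^] k \<otimes> t \<otimes> inv (c [^] k)"
  have v: "?v \<in> carrier W" using assms(1) by simp
  have "c [^] Suc k \<otimes> t \<otimes> inv (c [^] Suc k) = c \<otimes> ?v \<otimes> inv c"
    using assms(1) by (simp only: nat_pow_Suc2[OF c_closed])
      (simp add: inv_mult_group m_assoc del: nat_pow_Suc)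
  moreover have "inv c \<otimes> (c \<otimes> ?v \<otimes> inv c) \<otimes> c = ?v"
    using v by (simp add: m_assoc) (simp flip: m_assoc)
  ultimately have "reached ?v" using reached_conjugate[OF Suc.prems] by simp
  then show ?case by (rule Suc.IH)
qed

text \<open>A power of \<open>c\<close> conjugates \<open>t\<close> to a letter of \<open>xs\<close>
  conjugated by the suffix after it. That element is reached from \<open>xs\<close>, and conjugating
  back by \<open>c\<close> reaches \<open>t\<close>.\<close>

lemma gen_T_in_lift:
  assumes "t \<in> T"
  shows "gen t \<in> lift ` carrier W"
proof -
  obtain x where x: "C.reflects t x" using reflects_T[OF assms] by blast
  from C.reflection_conjugate_under_coxeter[OF set_xs distinct_xs x]
  obtain k :: nat and as s bs where "xs = as @ s # bs"
    "c [^] k \<otimes> t \<otimes> inv (c [^] k) = inv (list_product W bs) \<otimes> s \<otimes> list_product W bs"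
    by metis
  then have "reached t"
    using reached_if_pow_conjugate[of t k] reached_suffix_conjugate[of as s bs] assms by auto
  then show ?thesis by (simp add: reached_def)
qed

lemma lift_surj: "carrier P \<subseteq> lift ` carrier W"
proof
  fix A assume "A \<in> carrier P"
  then obtain u where u: "u \<in> lists (T \<times> UNIV)" "A = pres_class T Rel u"
    by (auto simp: carrier_presented_group)
  have "word_eval P gen u \<in> lift ` carrier W"
    using u(1)
  proof (induction u)
    case (Cons a u)
    then show ?case by (cases a) (auto simp: lift_image_closed gen_T_in_lift)
  qed (simp add: lift_image_closed)
  then show "A \<in> lift ` carrier W"
    using u pres_class_word_eval[OF u(1), of Rel] by (simp add: gen_def[abs_def])
qed

text \<open>\<open>\<theta>\<close> comes from von Dyck's theorem, and \<open>lift\<close> is a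
  right inverse of it, as is checked on \<open>S\<close>. Since \<open>lift\<close> is onto, it is a
  two-sided inverse.\<close>

lemma has_dual_presentation: "has_presentation W T Rel"
proof -
  define \<theta> where "\<theta> = pres_lift W (\<lambda>t. t)"
  have id: "(\<lambda>t. t) \<in> T \<rightarrow> carrier W" by auto
  have rel: "word_eval W (\<lambda>t. t) u = word_eval W (\<lambda>t. t) v" if "(u, v) \<in> Rel" for u v
    using that
  proof
    assume "(u, v) \<in> dual_braid_relations W T c"
    then show ?thesis
      by (auto simp: dual_braid_relations_def word_eval_positive m_assoc)
  next
    assume "(u, v) \<in> square_relations T"
    then show ?thesis by (auto simp: square_relations_def word_eval_positive T_square)
  qed
  have \<theta>: "\<theta> \<in> hom P W" "\<And>t. t \<in> T \<Longrightarrow> \<theta> (gen t) = t"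
    unfolding \<theta>_def gen_def
    by (rule pres_lift_hom[OF is_group id rel], assumption)
      (rule pres_lift_generator[OF is_group id rel], assumption+)
  interpret \<theta>: group_hom P W \<theta>
    using \<theta>(1) by (simp add: group_hom_def group_hom_axioms_def group_P is_group)
  interpret h: group_hom W P lift
    using lift(1) by (simp add: group_hom_def group_hom_axioms_def group_P is_group)
  have inverse: "\<theta> (lift w) = w" if "w \<in> carrier W" for w
    using that
  proof (induction rule: C.carrier_induct)
    case (step s w)
    then show ?case using lift(2)[of s] \<theta>(2)[of s] S_T by auto
  qed simp
  have "bij_betw \<theta> (carrier P) (carrier W)"
  proof (rule bij_betwI[where g = lift])
    show "lift (\<theta> A) = A" if "A \<in> carrier P" for A
      using lift_surj that inverse by auto
  qed (use inverse in auto)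
  then have "\<theta> \<in> iso P W" using \<theta>(1) by (simp add: iso_def)
  then show ?thesis
    unfolding has_presentation_def using \<theta>(2) T_carrier by (intro conjI bexI[of _ \<theta>]) (auto simp: gen_def)
qed

end

theorem corollary2p2p6:
  fixes W :: "('a, 'b) monoid_scheme" and T :: "'a set" and c :: 'a
  assumes "abstract_reflection_group TYPE('v::real_vector) W T"
    and "coxeter_element W T c"
  shows "has_presentation W T (dual_braid_relations W T c \<union> square_relations T)"
proof -
  have W: "group W" "finite (carrier W)" "T \<subseteq> carrier W"
    using assms(1) by (auto simp: abstract_reflection_group_def)
  obtain B :: "'v set" where B: "finite B" "span B = UNIV"
    using assms(1) by (auto simp: abstract_reflection_group_def)
  obtain \<rho> :: "'a \<Rightarrow> 'v \<Rightarrow> 'v" where \<rho>: "faithful_representation W \<rho>"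
    "\<And>w. w \<in> carrier W \<Longrightarrow> dim (UNIV :: 'v set) - dim {v. \<rho> w v - v = 0} = 1 \<longleftrightarrow> w \<in> T"
    using assms(1) by (auto simp: abstract_reflection_group_def)
  interpret R: reflection_representation W T \<rho> B
    using W B \<rho> by (simp add: reflection_representation_def reflection_representation_axioms_def)
  obtain S xs where S: "S \<subseteq> T" "coxeter_system W S" "distinct xs" "set xs = S"
    and c: "c = list_product W xs"
    by (rule coxeter_element_list[OF W(1) assms(2) W(2)]) (rule that)
  have fcg: "finite_coxeter_group W S"
    using W S(2) by (simp add: finite_coxeter_group_def finite_coxeter_group_axioms_def)
  \<comment> \<open>The given representation supplies the facts about \<open>T\<close>;
    \<open>reflects_if_in_T\<close> matches \<open>T\<close> with the roots of
    \<open>(W, S)\<close>.\<close>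
  interpret dual_presentation W T S xs
    by (intro dual_presentation.intro dual_presentation_axioms.intro)
      (fact W S R.T_square R.T_conjugate R.reflects_if_in_T[OF fcg S(1)])+
  show ?thesis unfolding c by (rule has_dual_presentation)
qed

end
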